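(* Let $\mathscr G_j=\{G_j: D_{\mathrm{KL}}(G_j,F_j)\le\epsilon_j\}$, $j\in\{0,1\}$, and $l=f_1/f_0$. The least favorable densities of the asymptotically minimax robust Type-I Neyman–Pearson test, i.e. the minimizing densities of $$\min_{(G_0,G_1)\in\mathscr G_0\times\mathscr G_1}D_{\mathrm{KL}}(G_0,G_1)\quad\text{s.t. } g_0>0,\ g_1>0,\ \int_\Omega g_0\,d\mu=1,\ \int_\Omega g_1\,d\mu=1,$$ are given by $$\hat g_0=\left(\lambda_1+\frac{\lambda_1}{\lambda_0}\right)^{-\frac1{\lambda_0}}\exp\left[-1-\frac{1+\mu_0}{\lambda_0}\right]W\left[\frac{\lambda_0\exp\left[\frac{-\lambda_1-\lambda_1\mu_0+\lambda_0\mu_1}{(1+\lambda_0)\lambda_1}\right]l^{-\frac{\lambda_0}{1+\lambda_0}}}{(1+\lambda_0)\lambda_1}\right]^{-\frac1{\lambda_0}}f_0,$$ $$\hat g_1=\left(\lambda_1+\frac{\lambda_1}{\lambda_0}\right)^{-\frac{1+\lambda_0}{\lambda_0}}\exp\left[-1-\frac{1+\mu_0}{\lambda_0}\right]W\left[\frac{\lambda_0\exp\left[\frac{-\lambda_1-\lambda_1\mu_0+\lambda_0\mu_1}{(1+\lambda_0)\lambda_1}\right]l^{-\frac{\lambda_0}{1+\lambda_0}}}{(1+\lambda_0)\lambda_1}\right]^{-\frac{1+\lambda_0}{\lambda_0}}f_0,$$ where $W$ is the Lambert-W function.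
   Context: $F_0,F_1$ are the nominal probability distributions on $\Omega$ under $\mathcal H_0,\mathcal H_1$, with densities $f_0,f_1$ with respect to a dominating measure $\mu$; $g_j$ is the density of $G_j$. For distributions $P,Q$ with densities $p,q$, $D_{\mathrm{KL}}(P,Q)=\int_\Omega\log(p/q)\,p\,d\mu$; $\epsilon_0,\epsilon_1$ are the robustness parameters. Write $\Upsilon(G)=\int_\Omega g\,d\mu$. The scalars $\lambda_j,\mu_j$ are the Lagrangian (KKT) multipliers in $$L_j=D_{\mathrm{KL}}(G_0,G_1)+\lambda_j\bigl(D_{\mathrm{KL}}(G_j,F_j)-\epsilon_j\bigr)+\mu_j\bigl(\Upsilon(G_j)-1\bigr),\quad j\in\{0,1\},$$ and are determined by the four equations $\Upsilon(\hat G_0)=1$, $\Upsilon(\hat G_1)=1$, $D_{\mathrm{KL}}(\hat G_0,F_0)=\epsilon_0$, $D_{\mathrm{KL}}(\hat G_1,F_1)=\epsilon_1$. *)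

theory Defs
  imports "HOL-Analysis.Analysis"
begin

definition total_mass :: "'a measure \<Rightarrow> ('a \<Rightarrow> real) \<Rightarrow> real" where
  "total_mass M g = (\<integral>x. g x \<partial>M)"

text \<open>
  The Bochner integral of a non-integrable function is 0, so \<open>total_mass M g = 1\<close>
  entails integrability of \<open>g\<close>.
\<close>
definition prob_density :: "'a measure \<Rightarrow> ('a \<Rightarrow> real) \<Rightarrow> bool" where
  "prob_density M g \<longleftrightarrow>
     g \<in> borel_measurable M \<and> (AE x in M. 0 \<le> g x) \<and> total_mass M g = 1"

text \<open>
  For probability densities the negative part of \<open>p ln (p / q)\<close> is always integrable, so
  the integral of \<open>p ln (p / q)\<close> exists in the extended sense and is \<open>\<infinity>\<close> exactly when the
  integrand is not integrable. The first conjunct is absolute continuity; it is spelled out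
  because \<open>p / 0 = 0\<close> and \<open>ln 0 = 0\<close>. Returning \<open>\<infinity>\<close> (rather than the value 0 of a
  non-integrable Bochner integral) keeps densities of infinite divergence out of the
  uncertainty sets.
\<close>
definition D_KL :: "'a measure \<Rightarrow> ('a \<Rightarrow> real) \<Rightarrow> ('a \<Rightarrow> real) \<Rightarrow> ereal" where
  "D_KL M p q =
     (if (AE x in M. q x = 0 \<longrightarrow> p x = 0) \<and> integrable M (\<lambda>x. ln (p x / q x) * p x)
      then ereal (\<integral>x. ln (p x / q x) * p x \<partial>M) else \<infinity>)"

definition uncertainty_set :: "'a measure \<Rightarrow> ('a \<Rightarrow> real) \<Rightarrow> real \<Rightarrow> ('a \<Rightarrow> real) set" where
  "uncertainty_set M f \<epsilon> = {g. prob_density M g \<and> D_KL M g f \<le> ereal \<epsilon>}"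

definition feasible ::
  "'a measure \<Rightarrow> ('a \<Rightarrow> real) \<Rightarrow> ('a \<Rightarrow> real) \<Rightarrow> real \<Rightarrow> real
   \<Rightarrow> ('a \<Rightarrow> real) \<times> ('a \<Rightarrow> real) \<Rightarrow> bool" where
  "feasible M f0 f1 \<epsilon>0 \<epsilon>1 = (\<lambda>(g0, g1).
     g0 \<in> uncertainty_set M f0 \<epsilon>0 \<and> g1 \<in> uncertainty_set M f1 \<epsilon>1 \<and>
     (AE x in M. g0 x > 0) \<and> (AE x in M. g1 x > 0) \<and>
     total_mass M g0 = 1 \<and> total_mass M g1 = 1)"

definition least_favorable ::
  "'a measure \<Rightarrow> ('a \<Rightarrow> real) \<Rightarrow> ('a \<Rightarrow> real) \<Rightarrow> real \<Rightarrow> real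
   \<Rightarrow> ('a \<Rightarrow> real) \<Rightarrow> ('a \<Rightarrow> real) \<Rightarrow> bool" where
  "least_favorable M f0 f1 \<epsilon>0 \<epsilon>1 g0 g1 \<longleftrightarrow>
     is_arg_min (\<lambda>(h0, h1). D_KL M h0 h1) (feasible M f0 f1 \<epsilon>0 \<epsilon>1) (g0, g1)"

text \<open>
  Principal real branch of the Lambert W function, meaningful for \<open>x \<ge> - exp (- 1)\<close>.
\<close>
definition Lambert_W :: "real \<Rightarrow> real" where
  "Lambert_W x = (THE w. - 1 \<le> w \<and> w * exp w = x)"

definition W_term ::
  "real \<Rightarrow> real \<Rightarrow> real \<Rightarrow> real \<Rightarrow> ('a \<Rightarrow> real) \<Rightarrow> ('a \<Rightarrow> real) \<Rightarrow> 'a \<Rightarrow> real" where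
  "W_term lam0 lam1 mu0 mu1 f0 f1 x =
     Lambert_W
       (lam0 * exp ((- lam1 - lam1 * mu0 + lam0 * mu1) / ((1 + lam0) * lam1))
            * (f1 x / f0 x) powr (- (lam0 / (1 + lam0)))
        / ((1 + lam0) * lam1))"

definition g0_hat ::
  "real \<Rightarrow> real \<Rightarrow> real \<Rightarrow> real \<Rightarrow> ('a \<Rightarrow> real) \<Rightarrow> ('a \<Rightarrow> real) \<Rightarrow> 'a \<Rightarrow> real" where
  "g0_hat lam0 lam1 mu0 mu1 f0 f1 x =
     (lam1 + lam1 / lam0) powr (- (1 / lam0))
     * exp (- 1 - (1 + mu0) / lam0)
     * W_term lam0 lam1 mu0 mu1 f0 f1 x powr (- (1 / lam0)) * f0 x"

definition g1_hat ::
  "real \<Rightarrow> real \<Rightarrow> real \<Rightarrow> real \<Rightarrow> ('a \<Rightarrow> real) \<Rightarrow> ('a \<Rightarrow> real) \<Rightarrow> 'a \<Rightarrow> real" where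
  "g1_hat lam0 lam1 mu0 mu1 f0 f1 x =
     (lam1 + lam1 / lam0) powr (- ((1 + lam0) / lam0))
     * exp (- 1 - (1 + mu0) / lam0)
     * W_term lam0 lam1 mu0 mu1 f0 f1 x powr (- ((1 + lam0) / lam0)) * f0 x"

text \<open>
  The multipliers of the inequality constraints are nonnegative by the KKT conditions, and
  the closed forms divide by both of them; hence strict positivity.
\<close>
definition multipliers ::
  "'a measure \<Rightarrow> ('a \<Rightarrow> real) \<Rightarrow> ('a \<Rightarrow> real) \<Rightarrow> real \<Rightarrow> real
   \<Rightarrow> real \<Rightarrow> real \<Rightarrow> real \<Rightarrow> real \<Rightarrow> bool" where
  "multipliers M f0 f1 \<epsilon>0 \<epsilon>1 lam0 lam1 mu0 mu1 \<longleftrightarrow>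
     lam0 > 0 \<and> lam1 > 0 \<and>
     total_mass M (g0_hat lam0 lam1 mu0 mu1 f0 f1) = 1 \<and>
     total_mass M (g1_hat lam0 lam1 mu0 mu1 f0 f1) = 1 \<and>
     D_KL M (g0_hat lam0 lam1 mu0 mu1 f0 f1) f0 = ereal \<epsilon>0 \<and>
     D_KL M (g1_hat lam0 lam1 mu0 mu1 f0 f1) f1 = ereal \<epsilon>1"

end

theory Submission
  imports Defs
begin

text \<open>
  The closed forms solve the pointwise stationarity equations of the Lagrangian, which is a convex
  function of \<open>(g\<^sub>0, g\<^sub>1)\<close>. Its excess over the stationary value is a sum of Bregman gaps
  \<open>x ln (x / y) - x + y\<close>, so integrating gives weak duality, optimality and uniqueness.

  Multipliers are found by maximising the four-dimensional dual function on the region of positive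
  \<open>\<lambda>\<^sub>0, \<lambda>\<^sub>1\<close>, where a zero of the supergradient is exactly a solution of the four constraint
  equations. Testing weak duality with multiples of the geometric mixtures
  \<open>p\<^sub>s \<propto> f\<^sub>0\<^bsup>1-s\<^esup> f\<^sub>1\<^bsup>s\<^esup>\<close> shows that \<open>{dual \<ge> \<delta>}\<close> is bounded and stays away from \<open>\<lambda>\<^sub>j = 0\<close> for
  every \<open>\<delta> > 0\<close>. If no \<open>p\<^sub>s\<close> lies in both uncertainty sets, then by continuity some \<open>p\<^sub>s\<close> violates
  both constraints, hence \<open>- ln (\<integral> f\<^sub>0\<^bsup>1-s\<^esup> f\<^sub>1\<^bsup>s\<^esup>) > (1 - s) \<epsilon>\<^sub>0 + s \<epsilon>\<^sub>1\<close>. This number minus the right-hand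
  side is the derivative of the dual function at the boundary point
  \<open>(\<lambda>\<^sub>0, \<lambda>\<^sub>1, \<mu>\<^sub>0, \<mu>\<^sub>1) = (0, 0, -1, 1)\<close>, where it vanishes, in the direction
  \<open>(1 - s, s, 0, ln Z - 1)\<close> with \<open>Z = \<integral> f\<^sub>0\<^bsup>1-s\<^esup> f\<^sub>1\<^bsup>s\<^esup>\<close>.
  So the dual function is positive somewhere and attains its maximum.
\<close>

section \<open>The Lambert function and the stationarity equations\<close>

text \<open>Existence is the intermediate value theorem on \<open>[0, x]\<close>, since
  \<open>x * exp x \<ge> x\<close> there. The definite description admits solutions down to -1, but
  a nonnegative value of \<open>w * exp w\<close> forces \<open>w \<ge> 0\<close>, where the
  function is strictly increasing.\<close>

lemma Lambert_W_nonneg_solution: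
  assumes "0 \<le> x"
  shows "0 \<le> Lambert_W x" and "Lambert_W x * exp (Lambert_W x) = x"
proof -
  have "\<exists>w\<ge>0. w \<le> x \<and> w * exp w = x"
    by (rule IVT') (use assms mult_left_mono[of 1 "exp x" x] in \<open>auto intro!: continuous_intros\<close>)
  then obtain w where w: "0 \<le> w" "w * exp w = x" by blast
  have uniq: "v = w" if v: "-1 \<le> v" "v * exp v = x" for v :: real
  proof -
    have "0 \<le> v" using assms v(2) by (metis exp_gt_zero mult_neg_pos not_less)
    show ?thesis
    proof (rule ccontr)
      assume "v \<noteq> w"
      then consider "v < w" | "w < v" by linarith
      then show False
      proof cases
        case 1
        then have "v * exp v < w * exp w" using \<open>0 \<le> v\<close> by (intro mult_strict_mono') auto
        then show False using v w by simp
      next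
        case 2
        then have "w * exp w < v * exp v" using w by (intro mult_strict_mono') auto
        then show False using v w by simp
      qed
    qed
  qed
  have "Lambert_W x = w"
    unfolding Lambert_W_def by (rule the_equality) (use w uniq in auto)
  then show "0 \<le> Lambert_W x" "Lambert_W x * exp (Lambert_W x) = x" using w by auto
qed

lemma Lambert_W_pos: "0 < x \<Longrightarrow> 0 < Lambert_W x"
  using Lambert_W_nonneg_solution[of x] by (cases "Lambert_W x = 0") auto

text \<open>The slope of \<open>w * exp w\<close> is at least 1 on the nonnegative reals, so its
  inverse is 1-Lipschitz there. Continuity and measurability of W rest on this.\<close>

lemma mult_exp_expanding:
  fixes v w :: real
  assumes "0 \<le> v" "v \<le> w"
  shows "w - v \<le> w * exp w - v * exp v"
proof -
  have "(w - v) * 1 \<le> (w - v) * exp w"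
    using assms by (intro mult_left_mono) auto
  moreover have "v * exp v \<le> v * exp w"
    using assms by (intro mult_left_mono) auto
  ultimately show ?thesis by (simp add: algebra_simps)
qed

lemma Lambert_W_lipschitz:
  assumes "0 \<le> x" "0 \<le> y"
  shows "\<bar>Lambert_W x - Lambert_W y\<bar> \<le> \<bar>x - y\<bar>"
  using mult_exp_expanding[of "Lambert_W x" "Lambert_W y"]
    mult_exp_expanding[of "Lambert_W y" "Lambert_W x"]
    Lambert_W_nonneg_solution[OF assms(1)] Lambert_W_nonneg_solution[OF assms(2)]
  by linarith

lemma continuous_on_Lambert_W: "continuous_on {0..} Lambert_W"
  unfolding continuous_on_iff dist_real_def
  by (metis Lambert_W_lipschitz atLeast_iff order.strict_trans1)

text \<open>Truncation at 0 changes nothing on the nonnegative axis, where all later arguments lie,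
  and makes the composite continuous on the whole line.\<close>

lemma borel_measurable_Lambert_W_max: "(\<lambda>x. Lambert_W (max 0 x)) \<in> borel_measurable borel"
  by (intro borel_measurable_continuous_onI continuous_on_compose2[OF continuous_on_Lambert_W])
    (auto intro!: continuous_intros)

text \<open>With \<open>a\<close>, \<open>b\<close> the values of the nominal densities at a point,
  the two equations say that the derivatives in \<open>p\<close> and in \<open>q\<close> of the
  Lagrangian integrand \<open>p ln (p/q) + lam0 p ln (p/a) + mu0 p + lam1 q ln (q/b) + mu1 q\<close>
  vanish.\<close>

definition stationary :: "real \<Rightarrow> real \<Rightarrow> real \<Rightarrow> real \<Rightarrow> real \<Rightarrow> real \<Rightarrow> real \<Rightarrow> real \<Rightarrow> bool" where
  "stationary lam0 lam1 mu0 mu1 a b p q \<longleftrightarrow>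
     0 < p \<and> 0 < q \<and>
     (1 + lam0) * ln (p / a) = ln (q / a) - (1 + lam0 + mu0) \<and>
     p / q = lam1 * (ln (q / b) + 1) + mu1"

text \<open>In logarithms the closed forms are affine in \<open>ln c + ln w\<close>, and the first
  equation becomes linear algebra. In the second, the Lambert equation trades
  \<open>ln c + ln w\<close> for \<open>E - B * ln l - w\<close>, after which both sides equal
  \<open>c * w\<close>.\<close>

lemma stationary_hat:
  assumes lam: "0 < lam0" "0 < lam1" and f: "0 < f0 x" "0 < f1 x"
  shows "stationary lam0 lam1 mu0 mu1 (f0 x) (f1 x)
           (g0_hat lam0 lam1 mu0 mu1 f0 f1 x) (g1_hat lam0 lam1 mu0 mu1 f0 f1 x)"
proof -
  define w where "w = W_term lam0 lam1 mu0 mu1 f0 f1 x"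
  define p where "p = g0_hat lam0 lam1 mu0 mu1 f0 f1 x"
  define q where "q = g1_hat lam0 lam1 mu0 mu1 f0 f1 x"
  define E where "E = (- lam1 - lam1 * mu0 + lam0 * mu1) / ((1 + lam0) * lam1)"
  define l where "l = f1 x / f0 x"
  define c where "c = lam1 + lam1 / lam0"
  define B where "B = lam0 / (1 + lam0)"
  define y where "y = lam0 * exp E * l powr (- B) / ((1 + lam0) * lam1)"
  have l: "0 < l" using f by (simp add: l_def)
  have y: "0 < y" using lam l by (simp add: y_def)
  have w_eq: "w = Lambert_W y" by (simp add: w_def W_term_def y_def E_def B_def l_def)
  have w: "0 < w" "w * exp w = y"
    using Lambert_W_pos[OF y] Lambert_W_nonneg_solution[of y] y by (auto simp: w_eq)
  have c: "0 < c" using lam by (simp add: c_def add_pos_pos)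
  have c_eq: "c = lam1 * (1 + lam0) / lam0" using lam by (simp add: c_def field_simps)
  have ln_c: "ln c = ln lam1 + ln (1 + lam0) - ln lam0"
    unfolding c_eq using lam by (simp add: ln_div ln_mult)
  have ln_y: "ln y = E - B * ln l - ln c"
    unfolding y_def using lam l by (simp add: ln_div ln_mult ln_powr ln_c)
  have ln_w: "ln c + ln w = E - B * ln l - w"
    using arg_cong[OF w(2), of ln] w(1) ln_y by (simp add: ln_mult)
  have p: "p = c powr (- (1 / lam0)) * exp (- 1 - (1 + mu0) / lam0) * w powr (- (1 / lam0)) * f0 x"
    by (simp add: p_def g0_hat_def c_def w_def)
  have q: "q = c powr (- ((1 + lam0) / lam0)) * exp (- 1 - (1 + mu0) / lam0)
                * w powr (- ((1 + lam0) / lam0)) * f0 x"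
    by (simp add: q_def g1_hat_def c_def w_def)
  have pos: "0 < p" "0 < q" using c w f by (auto simp: p q)
  have ln_p: "ln (p / f0 x) = - (1 / lam0) * (ln c + ln w) - 1 - (1 + mu0) / lam0"
    using c w f by (simp add: p ln_mult ln_powr algebra_simps add_divide_distrib)
  have ln_q: "ln (q / f0 x) = - ((1 + lam0) / lam0) * (ln c + ln w) - 1 - (1 + mu0) / lam0"
    using c w f by (simp add: q ln_mult ln_powr algebra_simps add_divide_distrib)
  have e1: "(1 + lam0) * ln (p / f0 x) = ln (q / f0 x) - (1 + lam0 + mu0)"
    unfolding ln_p ln_q using lam by (simp add: field_simps)
  have "ln (p / q) = ln (p / f0 x) - ln (q / f0 x)"
    using pos f by (simp add: ln_div)
  also have "\<dots> = ln (c * w)"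
    unfolding ln_p ln_q using lam c w(1) by (simp add: field_simps ln_mult)
  finally have pq: "p / q = c * w" using pos c w by (simp add: ln_inj_iff)
  have lE: "lam1 * ((1 + lam0) / lam0) * E = (- lam1 - lam1 * mu0 + lam0 * mu1) / lam0"
    using lam by (simp add: E_def)
  \<comment> \<open>The exponent of the likelihood ratio inside W is chosen for this cancellation:
    the \<open>ln l\<close> terms drop out, and \<open>ln (q / f1 x)\<close> depends on the point
    only through \<open>w\<close>.\<close>
  have lB: "(1 + lam0) / lam0 * B = 1" using lam by (simp add: B_def)
  have "ln (q / f1 x) = ln (q / f0 x) - ln l"
    using pos f by (simp add: ln_div l_def)
  also have "\<dots> = - ((1 + lam0) / lam0) * E + (1 + lam0) / lam0 * B * ln l
       + ((1 + lam0) / lam0) * w - 1 - (1 + mu0) / lam0 - ln l"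
    unfolding ln_q ln_w by (simp add: algebra_simps)
  also have "\<dots> = - ((1 + lam0) / lam0) * E + ((1 + lam0) / lam0) * w - 1 - (1 + mu0) / lam0"
    unfolding lB by simp
  finally have ln_q1: "ln (q / f1 x) =
     - ((1 + lam0) / lam0) * E + ((1 + lam0) / lam0) * w - 1 - (1 + mu0) / lam0" .
  have "lam1 * (ln (q / f1 x) + 1) + mu1 =
     - (lam1 * ((1 + lam0) / lam0) * E) + lam1 * ((1 + lam0) / lam0) * w
     - lam1 * (1 + mu0) / lam0 + mu1"
  proof -
    have "lam1 * ((- k * E + k * w - 1 - m) + 1) + mu1
        = - (lam1 * k * E) + lam1 * k * w - lam1 * m + mu1" for k m
      by (simp add: algebra_simps)
    from this[of "(1 + lam0) / lam0" "(1 + mu0) / lam0"] show ?thesis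
      unfolding ln_q1 by simp
  qed
  also have "\<dots> = c * w"
    unfolding lE c_eq using lam by (simp add: field_simps)
  finally have e2: "p / q = lam1 * (ln (q / f1 x) + 1) + mu1" using pq by simp
  show ?thesis using pos e1 e2 by (simp add: stationary_def p_def q_def)
qed

section \<open>Bregman gaps and the pointwise Lagrangian\<close>

definition kl_gap :: "real \<Rightarrow> real \<Rightarrow> real" where
  "kl_gap x y = x * ln (x / y) - x + y"

lemma kl_gap_nonneg:
  assumes "0 < x" "0 < y"
  shows "0 \<le> kl_gap x y"
proof -
  have "ln (y / x) \<le> y / x - 1" using assms by (intro ln_le_minus_one) auto
  then have "x * ln (y / x) \<le> y - x"
    using mult_left_mono[of "ln (y / x)" "y / x - 1" x] assms by (simp add: field_simps)
  then show ?thesis using assms by (simp add: kl_gap_def ln_div algebra_simps)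
qed

lemma kl_gap_eq_0_iff:
  assumes "0 < x" "0 < y"
  shows "kl_gap x y = 0 \<longleftrightarrow> x = y"
proof
  assume 0: "kl_gap x y = 0"
  have "ln (y / x) = y / x - 1"
    using 0 assms by (simp add: kl_gap_def ln_div field_simps)
  then have "y / x = 1" using assms by (intro ln_eq_minus_one) auto
  then show "x = y" using assms by simp
qed (use assms in \<open>simp add: kl_gap_def\<close>)

text \<open>\<open>g0 ln (g0/g1)\<close> is jointly convex and homogeneous of degree one, so its
  excess over its tangent plane at \<open>(p, q)\<close> is the gap between \<open>g0\<close> and
  \<open>g1 * (p / q)\<close>. The two other gaps come from the penalty terms; stationarity cancels
  all terms linear in \<open>g0\<close> and \<open>g1\<close>, and leaves the value at
  \<open>(p, q)\<close>.\<close>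

lemma stationary_lagrangian:
  assumes st: "stationary lam0 lam1 mu0 mu1 a b p q"
    and pos: "0 < a" "0 < b" "0 < g0" "0 < g1"
  shows "ln (g0 / g1) * g0 + lam0 * (ln (g0 / a) * g0) + mu0 * g0
           + lam1 * (ln (g1 / b) * g1) + mu1 * g1
         = kl_gap g0 (g1 * (p / q)) + lam0 * kl_gap g0 p + lam1 * kl_gap g1 q
           - lam0 * p - lam1 * q"
proof -
  have pq: "0 < p" "0 < q" using st by (auto simp: stationary_def)
  have e1: "ln p = ln q - lam0 * (ln p - ln a) - (1 + lam0 + mu0)"
    using st pos pq by (simp add: stationary_def ln_div algebra_simps)
  have e2: "p / q = lam1 * (ln q - ln b + 1) + mu1"
    using st pos pq by (simp add: stationary_def ln_div)
  have l: "ln (g0 / (g1 * (p / q))) = ln g0 - ln g1 - ln p + ln q"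
    using pos pq by (simp add: ln_div ln_mult)
  have l': "g0 * (ln p - ln q) = g0 * (- lam0 * (ln p - ln a) - (1 + lam0 + mu0))"
    using e1 by simp
  have l'': "g1 * (p / q) = g1 * (lam1 * (ln q - ln b + 1) + mu1)"
    using e2 by simp
  show ?thesis
    using l' l'' unfolding kl_gap_def l using pos pq by (simp add: ln_div algebra_simps)
qed

section \<open>Bounds for stationary points, uniform in the multipliers\<close>

lemma abs_mult_ln_le_1:
  fixes u :: real
  assumes "0 < u" "u \<le> 1"
  shows "\<bar>u * ln u\<bar> \<le> 1"
proof -
  have "ln (1 / u) \<le> 1 / u - 1" using assms by (intro ln_le_minus_one) auto
  then have "u * ln (1 / u) \<le> u * (1 / u - 1)" using assms by (intro mult_left_mono) auto
  also have "\<dots> \<le> 1" using assms by (simp add: field_simps)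
  finally have "- (u * ln u) \<le> 1" using assms by (simp add: ln_div)
  moreover have "u * ln u \<le> 0" using assms by (simp add: mult_nonneg_nonpos)
  ultimately show ?thesis by linarith
qed

text \<open>If \<open>q > a\<close>, the first equation bounds \<open>p / q\<close> by
  \<open>exp R\<close>; the second then bounds \<open>lam1 * ln (q / b)\<close> by
  \<open>exp R + R\<close>. The constant depends on \<open>c\<close> and \<open>R\<close> only, as a
  common majorant for varying multipliers requires.\<close>

lemma stationary_q_bound:
  assumes st: "stationary lam0 lam1 mu0 mu1 a b p q" and pos: "0 < a" "0 < b"
    and box: "0 < c" "0 \<le> R" "0 < lam0" "c \<le> lam1" "\<bar>mu0\<bar> \<le> R" "\<bar>mu1\<bar> \<le> R"
  shows "q \<le> a + exp ((exp R + R) / c) * b"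
proof (cases "q \<le> a")
  case True
  moreover have "0 \<le> exp ((exp R + R) / c) * b" using pos by simp
  ultimately show ?thesis by linarith
next
  case False
  have pq: "0 < p" "0 < q" using st by (auto simp: stationary_def)
  have v: "0 < ln q - ln a" using False pos pq by simp
  have "(1 + lam0) * (ln p - ln a) = (ln q - ln a) - (1 + lam0 + mu0)"
    using st pos pq by (simp add: stationary_def ln_div)
  then have "(1 + lam0) * (ln p - ln q) = - (1 + lam0 + mu0) - lam0 * (ln q - ln a)"
    by (simp add: algebra_simps)
  also have "\<dots> \<le> R"
    using v box mult_nonneg_nonneg[of lam0 "ln q - ln a"] by linarith
  also have "\<dots> \<le> (1 + lam0) * R" using box by (simp add: algebra_simps)
  finally have "ln (p / q) \<le> R" using box pq by (simp add: ln_div)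
  then have r: "p / q \<le> exp R" using pq by (metis divide_pos_pos exp_ln exp_le_cancel_iff)
  have "lam1 * ln (q / b) = p / q - lam1 - mu1"
    using st by (simp add: stationary_def algebra_simps)
  also have "\<dots> \<le> exp R + R" using r box by linarith
  finally have l: "lam1 * ln (q / b) \<le> exp R + R" .
  have "ln (q / b) \<le> (exp R + R) / lam1" using l box by (simp add: field_simps)
  also have "\<dots> \<le> (exp R + R) / c"
    using box by (intro divide_left_mono) (auto intro!: add_nonneg_nonneg mult_pos_pos)
  finally have "q / b \<le> exp ((exp R + R) / c)"
    using pq pos by (metis divide_pos_pos exp_ln exp_le_cancel_iff)
  then have "q \<le> exp ((exp R + R) / c) * b" using pos by (simp add: field_simps)
  then show ?thesis using pos by linarith
qed

text \<open>For \<open>u = p / a\<close> the first equation gives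
  \<open>u powr (1 + lam0) \<le> exp R * q / a\<close>. When \<open>u \<ge> 1\<close>, this power
  dominates both \<open>u\<close> and \<open>lam0 * u * ln u\<close>, and
  \<open>lam0 \<ge> c\<close> turns the latter into a bound on \<open>u * ln u\<close>. When
  \<open>u \<le> 1\<close>, \<open>u * ln u\<close> is bounded by 1.\<close>

lemma
  assumes st: "stationary lam0 lam1 mu0 mu1 a b p q" and pos: "0 < a"
    and box: "0 < c" "0 \<le> R" "c \<le> lam0" "\<bar>mu0\<bar> \<le> R"
  shows stationary_p_bound: "p \<le> a + exp R * q"
    and stationary_p_ln_bound: "\<bar>ln (p / a) * p\<bar> \<le> a + exp R / c * q"
proof -
  have pq: "0 < p" "0 < q" using st by (auto simp: stationary_def)
  define u where "u = p / a"
  have u: "0 < u" "p = a * u" using pq pos by (auto simp: u_def)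
  have "(1 + lam0) * ln u = ln (q / a) - (1 + lam0 + mu0)"
    using st by (simp add: stationary_def u_def)
  also have "\<dots> \<le> ln (q / a) + R" using box by linarith
  finally have "exp ((1 + lam0) * ln u) \<le> exp (ln (q / a) + R)" by simp
  then have uq: "exp ((1 + lam0) * ln u) \<le> exp R * (q / a)"
    using pq pos by (simp add: exp_add mult.commute)
  have big: "p \<le> exp R * q \<and> \<bar>ln u * p\<bar> \<le> exp R / c * q" if "1 \<le> u"
  proof -
    have lu: "0 \<le> ln u" using that by simp
    have "u = exp (ln u)" using u by simp
    also have "\<dots> \<le> exp ((1 + lam0) * ln u)"
      using lu box by (simp add: mult_le_cancel_right1)
    finally have "u \<le> exp R * (q / a)" using uq by linarith
    then have 1: "p \<le> exp R * q" using pos by (simp add: u field_simps)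
    have "lam0 * ln u \<le> exp (lam0 * ln u)"
      using exp_ge_add_one_self[of "lam0 * ln u"] by linarith
    then have "lam0 * ln u * u \<le> exp (lam0 * ln u) * u" using u by (intro mult_right_mono) auto
    also have "\<dots> = exp ((1 + lam0) * ln u)"
      using u by (simp add: distrib_right exp_add)
    finally have "lam0 * ln u * u \<le> exp R * (q / a)" using uq by linarith
    moreover have "c * (ln u * u) \<le> lam0 * (ln u * u)"
      using box lu u by (intro mult_right_mono) auto
    ultimately have "c * (ln u * u) \<le> exp R * (q / a)" by (simp add: mult.assoc)
    then have "c * (ln u * u) * a \<le> exp R * (q / a) * a" using pos by (intro mult_right_mono) auto
    then have "ln u * p \<le> exp R / c * q" using box pos by (simp add: u field_simps)
    then show ?thesis using 1 lu pq by simp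
  qed
  have small: "p \<le> a \<and> \<bar>ln u * p\<bar> \<le> a" if "u \<le> 1"
  proof -
    have "\<bar>ln u * p\<bar> = a * \<bar>u * ln u\<bar>" using pos by (simp add: u abs_mult)
    also have "\<dots> \<le> a * 1"
      using abs_mult_ln_le_1[OF u(1) that] pos by (intro mult_left_mono) auto
    finally show ?thesis using that pos u by simp
  qed
  have nn: "0 \<le> exp R * q" "0 \<le> exp R / c * q" using pq box by auto
  show "p \<le> a + exp R * q" "\<bar>ln (p / a) * p\<bar> \<le> a + exp R / c * q"
    using big small nn pos unfolding u_def[symmetric] by (cases "u \<le> 1"; linarith)+
qed

section \<open>Weak duality and continuity of the dual function\<close>

locale positive_densities =
  fixes M :: "'a measure" and f0 f1 :: "'a \<Rightarrow> real"
  assumes density0: "prob_density M f0" and density1: "prob_density M f1"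
    and AE_pos0: "AE x in M. f0 x > 0" and AE_pos1: "AE x in M. f1 x > 0"
begin

lemma measurable_f [measurable]: "f0 \<in> borel_measurable M" "f1 \<in> borel_measurable M"
  using density0 density1 by (auto simp: prob_density_def)

lemma integral_f: "(\<integral>x. f0 x \<partial>M) = 1" "(\<integral>x. f1 x \<partial>M) = 1"
  using density0 density1 by (auto simp: prob_density_def total_mass_def)

lemma integrable_f: "integrable M f0" "integrable M f1"
  using integral_f not_integrable_integral_eq zero_neq_one by metis+

lemma AE_pos: "AE x in M. 0 < f0 x \<and> 0 < f1 x"
  using AE_pos0 AE_pos1 by eventually_elim simp

lemma measurable_W_term [measurable]:
  assumes "0 < lam0" "0 < lam1"
  shows "W_term lam0 lam1 mu0 mu1 f0 f1 \<in> borel_measurable M"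
proof -
  have "W_term lam0 lam1 mu0 mu1 f0 f1 = (\<lambda>x. Lambert_W (max 0
       (lam0 * exp ((- lam1 - lam1 * mu0 + lam0 * mu1) / ((1 + lam0) * lam1))
            * (f1 x / f0 x) powr (- (lam0 / (1 + lam0)))
        / ((1 + lam0) * lam1))))"
    using assms by (auto simp: W_term_def fun_eq_iff max_def)
  also have "\<dots> \<in> borel_measurable M"
    by (rule measurable_compose[OF _ borel_measurable_Lambert_W_max]) measurable
  finally show ?thesis .
qed

lemma measurable_hat:
  assumes "0 < lam0" "0 < lam1"
  shows "g0_hat lam0 lam1 mu0 mu1 f0 f1 \<in> borel_measurable M"
    and "g1_hat lam0 lam1 mu0 mu1 f0 f1 \<in> borel_measurable M"
  using measurable_W_term[OF assms, of mu0 mu1, measurable]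
  unfolding g0_hat_def g1_hat_def by measurable

lemma AE_stationary:
  assumes "0 < lam0" "0 < lam1"
  shows "AE x in M. 0 < f0 x \<and> 0 < f1 x \<and> stationary lam0 lam1 mu0 mu1 (f0 x) (f1 x)
           (g0_hat lam0 lam1 mu0 mu1 f0 f1 x) (g1_hat lam0 lam1 mu0 mu1 f0 f1 x)"
  using AE_pos by eventually_elim (simp add: stationary_hat assms)

section \<open>Integrability of the closed forms and of their divergence integrands\<close>

definition mass0 :: "real \<Rightarrow> real \<Rightarrow> real \<Rightarrow> real \<Rightarrow> real" where
  "mass0 lam0 lam1 mu0 mu1 = (\<integral>x. g0_hat lam0 lam1 mu0 mu1 f0 f1 x \<partial>M)"

definition mass1 :: "real \<Rightarrow> real \<Rightarrow> real \<Rightarrow> real \<Rightarrow> real" where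
  "mass1 lam0 lam1 mu0 mu1 = (\<integral>x. g1_hat lam0 lam1 mu0 mu1 f0 f1 x \<partial>M)"

definition kl0 :: "real \<Rightarrow> real \<Rightarrow> real \<Rightarrow> real \<Rightarrow> real" where
  "kl0 lam0 lam1 mu0 mu1 =
     (\<integral>x. ln (g0_hat lam0 lam1 mu0 mu1 f0 f1 x / f0 x) * g0_hat lam0 lam1 mu0 mu1 f0 f1 x \<partial>M)"

definition kl1 :: "real \<Rightarrow> real \<Rightarrow> real \<Rightarrow> real \<Rightarrow> real" where
  "kl1 lam0 lam1 mu0 mu1 =
     (\<integral>x. ln (g1_hat lam0 lam1 mu0 mu1 f0 f1 x / f1 x) * g1_hat lam0 lam1 mu0 mu1 f0 f1 x \<partial>M)"

definition kl01 :: "real \<Rightarrow> real \<Rightarrow> real \<Rightarrow> real \<Rightarrow> real" where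
  "kl01 lam0 lam1 mu0 mu1 =
     (\<integral>x. ln (g0_hat lam0 lam1 mu0 mu1 f0 f1 x / g1_hat lam0 lam1 mu0 mu1 f0 f1 x)
        * g0_hat lam0 lam1 mu0 mu1 f0 f1 x \<partial>M)"

text \<open>One constant serves a whole region of multipliers, so the same majorant yields
  integrability for fixed multipliers and dominated convergence for varying ones. The divergence
  from \<open>f1\<close> is absent because it reduces to the two masses in
  \<open>kl1_eq\<close>.\<close>

lemma hat_dominated:
  assumes c: "0 < c" and R: "0 \<le> R"
  shows "\<exists>C. \<forall>lam0\<ge>c. \<forall>lam1\<ge>c. \<forall>mu0 mu1. \<bar>mu0\<bar> \<le> R \<longrightarrow> \<bar>mu1\<bar> \<le> R \<longrightarrow>
    (AE x in M. \<bar>g0_hat lam0 lam1 mu0 mu1 f0 f1 x\<bar> \<le> C * (f0 x + f1 x) \<and>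
      \<bar>g1_hat lam0 lam1 mu0 mu1 f0 f1 x\<bar> \<le> C * (f0 x + f1 x) \<and>
      \<bar>ln (g0_hat lam0 lam1 mu0 mu1 f0 f1 x / f0 x) * g0_hat lam0 lam1 mu0 mu1 f0 f1 x\<bar>
        \<le> C * (f0 x + f1 x))"
proof -
  define K where "K = exp ((exp R + R) / c)"
  define C where "C = (1 + exp R + exp R / c) * (1 + K)"
  have K: "0 \<le> K" by (simp add: K_def)
  show ?thesis
  proof (intro exI[of _ C] allI impI)
    fix lam0 lam1 mu0 mu1
    assume box: "c \<le> lam0" "c \<le> lam1" "\<bar>mu0\<bar> \<le> R" "\<bar>mu1\<bar> \<le> R"
    have lam: "0 < lam0" "0 < lam1" using c box by auto
    \<comment> \<open>All three estimates have the form \<open>\<alpha> * a + \<beta> * q\<close>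
      with \<open>q \<le> a + K * b\<close>; \<open>C\<close> is the largest admissible
      \<open>\<alpha> + \<beta>\<close> times \<open>1 + K\<close>.\<close>
    have gen: "s \<le> C * (a + b)"
      if "s \<le> \<alpha> * a + \<beta> * q" "q \<le> a + K * b" "0 < a" "0 < b" "0 \<le> \<alpha>" "\<alpha> \<le> 1" "0 \<le> \<beta>"
        "\<beta> \<le> 1 + exp R + exp R / c - \<alpha>"
      for s \<alpha> \<beta> a b q
    proof -
      have nn: "0 \<le> K * a" "0 \<le> K * b" using that K by auto
      have "(1 + K) * (a + b) = a + b + K * a + K * b" by (simp add: algebra_simps)
      then have qa: "q \<le> (1 + K) * (a + b)" "a \<le> (1 + K) * (a + b)"
        using that nn by linarith+
      have 1: "\<beta> * q \<le> \<beta> * ((1 + K) * (a + b))" using qa that by (intro mult_left_mono) auto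
      have 2: "\<alpha> * a \<le> \<alpha> * ((1 + K) * (a + b))" using qa that by (intro mult_left_mono) auto
      have "s \<le> (\<alpha> + \<beta>) * ((1 + K) * (a + b))" using 1 2 that by (simp add: algebra_simps)
      also have "\<dots> \<le> (1 + exp R + exp R / c) * ((1 + K) * (a + b))"
        using that K by (intro mult_right_mono) auto
      finally show ?thesis by (simp add: C_def mult.assoc)
    qed
    show "AE x in M. \<bar>g0_hat lam0 lam1 mu0 mu1 f0 f1 x\<bar> \<le> C * (f0 x + f1 x) \<and>
      \<bar>g1_hat lam0 lam1 mu0 mu1 f0 f1 x\<bar> \<le> C * (f0 x + f1 x) \<and>
      \<bar>ln (g0_hat lam0 lam1 mu0 mu1 f0 f1 x / f0 x) * g0_hat lam0 lam1 mu0 mu1 f0 f1 x\<bar>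
        \<le> C * (f0 x + f1 x)"
      using AE_stationary[OF lam, of mu0 mu1]
    proof eventually_elim
      case (elim x)
      let ?p = "g0_hat lam0 lam1 mu0 mu1 f0 f1 x" and ?q = "g1_hat lam0 lam1 mu0 mu1 f0 f1 x"
      have st: "stationary lam0 lam1 mu0 mu1 (f0 x) (f1 x) ?p ?q" and f: "0 < f0 x" "0 < f1 x"
        using elim by auto
      have pq: "0 < ?p" "0 < ?q" using st by (auto simp: stationary_def)
      have q: "?q \<le> f0 x + K * f1 x"
        unfolding K_def using st f c R lam box by (intro stationary_q_bound)
      have p: "?p \<le> f0 x + exp R * ?q" "\<bar>ln (?p / f0 x) * ?p\<bar> \<le> f0 x + exp R / c * ?q"
        using stationary_p_bound[OF st f(1) c R] stationary_p_ln_bound[OF st f(1) c R] box by auto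
      have "?p \<le> C * (f0 x + f1 x)"
        by (rule gen[of _ 1 _ "exp R", OF _ q]) (use p f c in auto)
      moreover have "?q \<le> C * (f0 x + f1 x)"
        by (rule gen[of _ 0 _ 1, OF _ q]) (use f c in \<open>auto intro!: add_nonneg_nonneg\<close>)
      moreover have "\<bar>ln (?p / f0 x) * ?p\<bar> \<le> C * (f0 x + f1 x)"
        by (rule gen[of _ 1 _ "exp R / c", OF _ q]) (use p f c in auto)
      ultimately show ?case using pq by simp
    qed
  qed
qed

lemma
  assumes lam: "0 < lam0" "0 < lam1"
  shows integrable_g0_hat: "integrable M (g0_hat lam0 lam1 mu0 mu1 f0 f1)"
    and integrable_g1_hat: "integrable M (g1_hat lam0 lam1 mu0 mu1 f0 f1)"
    and integrable_kl0: "integrable M (\<lambda>x. ln (g0_hat lam0 lam1 mu0 mu1 f0 f1 x / f0 x)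
                            * g0_hat lam0 lam1 mu0 mu1 f0 f1 x)"
proof -
  note measurable_hat[OF lam, measurable]
  define c where "c = min lam0 lam1"
  define R where "R = max \<bar>mu0\<bar> \<bar>mu1\<bar>"
  have "0 < c" "0 \<le> R" using lam by (auto simp: c_def R_def)
  from hat_dominated[OF this] obtain C where C: "AE x in M. \<bar>g0_hat lam0 lam1 mu0 mu1 f0 f1 x\<bar> \<le> C * (f0 x + f1 x) \<and>
      \<bar>g1_hat lam0 lam1 mu0 mu1 f0 f1 x\<bar> \<le> C * (f0 x + f1 x) \<and>
      \<bar>ln (g0_hat lam0 lam1 mu0 mu1 f0 f1 x / f0 x) * g0_hat lam0 lam1 mu0 mu1 f0 f1 x\<bar>
        \<le> C * (f0 x + f1 x)"
    unfolding c_def R_def by (meson min.cobounded1 min.cobounded2 max.cobounded1 max.cobounded2)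
  have i: "integrable M (\<lambda>x. C * (f0 x + f1 x))" using integrable_f by simp
  have C': "AE x in M. \<bar>g0_hat lam0 lam1 mu0 mu1 f0 f1 x\<bar> \<le> \<bar>C * (f0 x + f1 x)\<bar> \<and>
      \<bar>g1_hat lam0 lam1 mu0 mu1 f0 f1 x\<bar> \<le> \<bar>C * (f0 x + f1 x)\<bar> \<and>
      \<bar>ln (g0_hat lam0 lam1 mu0 mu1 f0 f1 x / f0 x) * g0_hat lam0 lam1 mu0 mu1 f0 f1 x\<bar>
        \<le> \<bar>C * (f0 x + f1 x)\<bar>"
    using C by eventually_elim linarith
  show "integrable M (g0_hat lam0 lam1 mu0 mu1 f0 f1)"
    by (rule Bochner_Integration.integrable_bound[OF i]) (use C' in \<open>auto elim: AE_mp\<close>)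
  show "integrable M (g1_hat lam0 lam1 mu0 mu1 f0 f1)"
    by (rule Bochner_Integration.integrable_bound[OF i]) (use C' in \<open>auto elim: AE_mp\<close>)
  show "integrable M (\<lambda>x. ln (g0_hat lam0 lam1 mu0 mu1 f0 f1 x / f0 x)
                            * g0_hat lam0 lam1 mu0 mu1 f0 f1 x)"
    by (rule Bochner_Integration.integrable_bound[OF i]) (use C' in \<open>auto elim: AE_mp\<close>)
qed

text \<open>Multiplied by \<open>q\<close>, the second stationarity equation expresses
  \<open>ln (q / f1) * q\<close> as a linear combination of \<open>p\<close> and \<open>q\<close>;
  integrability and the value follow from the masses.\<close>

lemma
  assumes lam: "0 < lam0" "0 < lam1"
  shows integrable_kl1: "integrable M (\<lambda>x. ln (g1_hat lam0 lam1 mu0 mu1 f0 f1 x / f1 x)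
                            * g1_hat lam0 lam1 mu0 mu1 f0 f1 x)" (is "integrable M ?h")
    and kl1_eq: "kl1 lam0 lam1 mu0 mu1 =
      (mass0 lam0 lam1 mu0 mu1 - (lam1 + mu1) * mass1 lam0 lam1 mu0 mu1) / lam1"
proof -
  note [measurable] = measurable_hat[OF lam]
  let ?k = "\<lambda>x. (g0_hat lam0 lam1 mu0 mu1 f0 f1 x - (lam1 + mu1) * g1_hat lam0 lam1 mu0 mu1 f0 f1 x) / lam1"
  note i = integrable_g0_hat[OF lam, of mu0 mu1] integrable_g1_hat[OF lam, of mu0 mu1]
  have AE: "AE x in M. ?h x = ?k x"
    using AE_stationary[OF lam, of mu0 mu1]
  proof eventually_elim
    case (elim x)
    let ?p = "g0_hat lam0 lam1 mu0 mu1 f0 f1 x" and ?q = "g1_hat lam0 lam1 mu0 mu1 f0 f1 x"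
    have "0 < ?q" "?p / ?q = lam1 * (ln (?q / f1 x) + 1) + mu1"
      using elim by (auto simp: stationary_def)
    then have "?p = (lam1 * (ln (?q / f1 x) + 1) + mu1) * ?q" by (simp add: field_simps)
    then show ?case using lam by (simp add: field_simps)
  qed
  have k: "integrable M ?k" using i by simp
  show "integrable M ?h"
    by (rule integrable_cong_AE_imp[OF k]) (use AE in \<open>auto elim: AE_mp\<close>)
  have "kl1 lam0 lam1 mu0 mu1 = (\<integral>x. ?k x \<partial>M)"
    unfolding kl1_def by (rule integral_cong_AE) (use AE in auto)
  also have "\<dots> = (mass0 lam0 lam1 mu0 mu1 - (lam1 + mu1) * mass1 lam0 lam1 mu0 mu1) / lam1"
    unfolding mass0_def mass1_def using i by simp
  finally show "kl1 lam0 lam1 mu0 mu1 =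
      (mass0 lam0 lam1 mu0 mu1 - (lam1 + mu1) * mass1 lam0 lam1 mu0 mu1) / lam1" .
qed

text \<open>The first stationarity equation replaces \<open>ln (p / q)\<close> by an affine function
  of \<open>ln (p / f0)\<close>. Together with \<open>kl1_eq\<close> this evaluates the Lagrangian
  at the closed forms, where everything but the stationary value cancels.\<close>

lemma
  assumes lam: "0 < lam0" "0 < lam1"
  shows integrable_kl01: "integrable M (\<lambda>x. ln (g0_hat lam0 lam1 mu0 mu1 f0 f1 x
      / g1_hat lam0 lam1 mu0 mu1 f0 f1 x) * g0_hat lam0 lam1 mu0 mu1 f0 f1 x)" (is "integrable M ?h")
    and lagrangian_hat: "kl01 lam0 lam1 mu0 mu1 + lam0 * kl0 lam0 lam1 mu0 mu1
        + mu0 * mass0 lam0 lam1 mu0 mu1 + lam1 * kl1 lam0 lam1 mu0 mu1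
        + mu1 * mass1 lam0 lam1 mu0 mu1
      = - lam0 * mass0 lam0 lam1 mu0 mu1 - lam1 * mass1 lam0 lam1 mu0 mu1"
proof -
  note [measurable] = measurable_hat[OF lam]
  let ?k = "\<lambda>x. - (1 + lam0 + mu0) * g0_hat lam0 lam1 mu0 mu1 f0 f1 x
     - lam0 * (ln (g0_hat lam0 lam1 mu0 mu1 f0 f1 x / f0 x) * g0_hat lam0 lam1 mu0 mu1 f0 f1 x)"
  note i = integrable_g0_hat[OF lam, of mu0 mu1] integrable_kl0[OF lam, of mu0 mu1]
  have AE: "AE x in M. ?h x = ?k x"
    using AE_stationary[OF lam, of mu0 mu1]
  proof eventually_elim
    case (elim x)
    let ?p = "g0_hat lam0 lam1 mu0 mu1 f0 f1 x" and ?q = "g1_hat lam0 lam1 mu0 mu1 f0 f1 x"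
    have pos: "0 < ?p" "0 < ?q" "0 < f0 x"
      and e: "(1 + lam0) * ln (?p / f0 x) = ln (?q / f0 x) - (1 + lam0 + mu0)"
      using elim by (auto simp: stationary_def)
    have "ln (?p / ?q) = ln (?p / f0 x) - ln (?q / f0 x)" using pos by (simp add: ln_div)
    also have "\<dots> = - (1 + lam0 + mu0) - lam0 * ln (?p / f0 x)"
      using e by (simp add: algebra_simps)
    finally have e': "ln (?p / ?q) = - (1 + lam0 + mu0) - lam0 * ln (?p / f0 x)" .
    show ?case unfolding e' by (simp add: algebra_simps)
  qed
  have k: "integrable M ?k" by (intro Bochner_Integration.integrable_diff integrable_mult_right i)
  show "integrable M ?h"
    by (rule integrable_cong_AE_imp[OF k]) (use AE in \<open>auto elim: AE_mp\<close>)
  have "kl01 lam0 lam1 mu0 mu1 = (\<integral>x. ?k x \<partial>M)"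
    unfolding kl01_def by (rule integral_cong_AE) (use AE in auto)
  also have "\<dots> = (\<integral>x. - (1 + lam0 + mu0) * g0_hat lam0 lam1 mu0 mu1 f0 f1 x \<partial>M)
    - (\<integral>x. lam0 * (ln (g0_hat lam0 lam1 mu0 mu1 f0 f1 x / f0 x)
        * g0_hat lam0 lam1 mu0 mu1 f0 f1 x) \<partial>M)"
    by (intro Bochner_Integration.integral_diff integrable_mult_right i)
  also have "\<dots> = - (1 + lam0 + mu0) * mass0 lam0 lam1 mu0 mu1 - lam0 * kl0 lam0 lam1 mu0 mu1"
    unfolding mass0_def kl0_def by (simp only: integral_mult_right_zero)
  finally have 01: "kl01 lam0 lam1 mu0 mu1
    = - (1 + lam0 + mu0) * mass0 lam0 lam1 mu0 mu1 - lam0 * kl0 lam0 lam1 mu0 mu1" .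
  have 1: "lam1 * kl1 lam0 lam1 mu0 mu1
      = mass0 lam0 lam1 mu0 mu1 - (lam1 + mu1) * mass1 lam0 lam1 mu0 mu1"
    unfolding kl1_eq[OF lam] using lam by simp
  show "kl01 lam0 lam1 mu0 mu1 + lam0 * kl0 lam0 lam1 mu0 mu1
        + mu0 * mass0 lam0 lam1 mu0 mu1 + lam1 * kl1 lam0 lam1 mu0 mu1
        + mu1 * mass1 lam0 lam1 mu0 mu1
      = - lam0 * mass0 lam0 lam1 mu0 mu1 - lam1 * mass1 lam0 lam1 mu0 mu1"
    unfolding 01 1 by (simp add: algebra_simps)
qed

text \<open>By \<open>stationary_lagrangian\<close>, \<open>gap\<close> is a nonnegative combination
  of Bregman gaps, and its integral is the excess of \<open>L\<close> over the stationary value. If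
  the excess is 0, then \<open>gap\<close> vanishes almost everywhere, and the terms weighted by the
  positive \<open>lam0\<close> and \<open>lam1\<close> identify \<open>g0\<close> and
  \<open>g1\<close>.\<close>

lemma
  fixes lam0 lam1 mu0 mu1 :: real and g0 g1 :: "'a \<Rightarrow> real"
  assumes lam: "0 < lam0" "0 < lam1"
    and g: "integrable M g0" "integrable M g1"
    and pos: "AE x in M. 0 < g0 x" "AE x in M. 0 < g1 x"
    and kl: "integrable M (\<lambda>x. ln (g0 x / g1 x) * g0 x)"
      "integrable M (\<lambda>x. ln (g0 x / f0 x) * g0 x)" "integrable M (\<lambda>x. ln (g1 x / f1 x) * g1 x)"
  defines "L \<equiv> (\<integral>x. ln (g0 x / g1 x) * g0 x \<partial>M) + lam0 * (\<integral>x. ln (g0 x / f0 x) * g0 x \<partial>M)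
     + mu0 * (\<integral>x. g0 x \<partial>M) + lam1 * (\<integral>x. ln (g1 x / f1 x) * g1 x \<partial>M) + mu1 * (\<integral>x. g1 x \<partial>M)"
  shows weak_duality: "- lam0 * mass0 lam0 lam1 mu0 mu1 - lam1 * mass1 lam0 lam1 mu0 mu1 \<le> L"
    and weak_duality_eq: "L = - lam0 * mass0 lam0 lam1 mu0 mu1 - lam1 * mass1 lam0 lam1 mu0 mu1 \<Longrightarrow>
      (AE x in M. g0 x = g0_hat lam0 lam1 mu0 mu1 f0 f1 x) \<and>
      (AE x in M. g1 x = g1_hat lam0 lam1 mu0 mu1 f0 f1 x)"
proof -
  define gap where "gap x = ln (g0 x / g1 x) * g0 x + lam0 * (ln (g0 x / f0 x) * g0 x)
     + mu0 * g0 x + lam1 * (ln (g1 x / f1 x) * g1 x) + mu1 * g1 x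
     + lam0 * g0_hat lam0 lam1 mu0 mu1 f0 f1 x + lam1 * g1_hat lam0 lam1 mu0 mu1 f0 f1 x" for x
  note hat = integrable_g0_hat[OF lam, of mu0 mu1] integrable_g1_hat[OF lam, of mu0 mu1]
  have int: "integrable M gap"
    unfolding gap_def
    by (intro Bochner_Integration.integrable_add integrable_mult_right kl g hat)
  have eq: "(\<integral>x. gap x \<partial>M) = L + lam0 * mass0 lam0 lam1 mu0 mu1 + lam1 * mass1 lam0 lam1 mu0 mu1"
    unfolding gap_def L_def mass0_def mass1_def using kl g hat
    by (simp del: times_divide_eq_left times_divide_eq_right)
  have AE: "AE x in M. 0 \<le> gap x \<and> (gap x = 0 \<longrightarrow> g0 x = g0_hat lam0 lam1 mu0 mu1 f0 f1 x \<and>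
      g1 x = g1_hat lam0 lam1 mu0 mu1 f0 f1 x)"
    using AE_stationary[OF lam, of mu0 mu1] pos
  proof eventually_elim
    case (elim x)
    let ?p = "g0_hat lam0 lam1 mu0 mu1 f0 f1 x" and ?q = "g1_hat lam0 lam1 mu0 mu1 f0 f1 x"
    have pq: "0 < ?p" "0 < ?q" and gp: "0 < g0 x" "0 < g1 x"
      using elim by (auto simp: stationary_def)
    have gap: "gap x = kl_gap (g0 x) (g1 x * (?p / ?q)) + lam0 * kl_gap (g0 x) ?p
        + lam1 * kl_gap (g1 x) ?q"
      unfolding gap_def using stationary_lagrangian[of lam0 lam1 mu0 mu1 "f0 x" "f1 x" ?p ?q "g0 x" "g1 x"]
        elim by simp
    have nn: "0 \<le> kl_gap (g0 x) (g1 x * (?p / ?q))"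
      using pq gp by (intro kl_gap_nonneg) auto
    have nn0: "0 \<le> lam0 * kl_gap (g0 x) ?p" and nn1: "0 \<le> lam1 * kl_gap (g1 x) ?q"
      using kl_gap_nonneg pq gp lam by auto
    have "kl_gap (g0 x) ?p = 0 \<and> kl_gap (g1 x) ?q = 0" if "gap x = 0"
    proof -
      have "lam0 * kl_gap (g0 x) ?p = 0" "lam1 * kl_gap (g1 x) ?q = 0"
        using that nn nn0 nn1 unfolding gap by linarith+
      then show ?thesis using lam by simp
    qed
    then show ?case using nn nn0 nn1 kl_gap_eq_0_iff pq gp unfolding gap by auto
  qed
  have nn: "AE x in M. 0 \<le> gap x" using AE by (auto elim: AE_mp)
  have "0 \<le> (\<integral>x. gap x \<partial>M)" by (intro integral_nonneg_AE nn)
  then show "- lam0 * mass0 lam0 lam1 mu0 mu1 - lam1 * mass1 lam0 lam1 mu0 mu1 \<le> L"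
    using eq by simp
  assume "L = - lam0 * mass0 lam0 lam1 mu0 mu1 - lam1 * mass1 lam0 lam1 mu0 mu1"
  then have "AE x in M. gap x = 0"
    using integral_nonneg_eq_0_iff_AE[OF int nn] eq by simp
  with AE have "AE x in M. g0 x = g0_hat lam0 lam1 mu0 mu1 f0 f1 x \<and>
      g1 x = g1_hat lam0 lam1 mu0 mu1 f0 f1 x"
    by eventually_elim simp
  then show "(AE x in M. g0 x = g0_hat lam0 lam1 mu0 mu1 f0 f1 x) \<and>
      (AE x in M. g1 x = g1_hat lam0 lam1 mu0 mu1 f0 f1 x)" by auto
qed

text \<open>The Lagrange dual function in closed form, for positive \<open>lam0\<close> and
  \<open>lam1\<close>: the minimum of the Lagrangian over positive functions of arbitrary mass with
  integrable divergence integrands. \<open>weak_duality\<close> gives the bound,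
  \<open>lagrangian_hat\<close> the attainment.\<close>

definition dual :: "real \<Rightarrow> real \<Rightarrow> real \<Rightarrow> real \<Rightarrow> real \<Rightarrow> real \<Rightarrow> real" where
  "dual e0 e1 lam0 lam1 mu0 mu1 = - lam0 * mass0 lam0 lam1 mu0 mu1 - lam1 * mass1 lam0 lam1 mu0 mu1
     - lam0 * e0 - lam1 * e1 - mu0 - mu1"

lemma dual_le_lagrangian:
  assumes "0 < lam0" "0 < lam1" "integrable M g0" "integrable M g1"
    and "AE x in M. 0 < g0 x" "AE x in M. 0 < g1 x"
    and "integrable M (\<lambda>x. ln (g0 x / g1 x) * g0 x)"
      "integrable M (\<lambda>x. ln (g0 x / f0 x) * g0 x)" "integrable M (\<lambda>x. ln (g1 x / f1 x) * g1 x)"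
  shows "dual e0 e1 lam0 lam1 mu0 mu1 \<le> (\<integral>x. ln (g0 x / g1 x) * g0 x \<partial>M)
    + lam0 * ((\<integral>x. ln (g0 x / f0 x) * g0 x \<partial>M) - e0) + mu0 * ((\<integral>x. g0 x \<partial>M) - 1)
    + lam1 * ((\<integral>x. ln (g1 x / f1 x) * g1 x \<partial>M) - e1) + mu1 * ((\<integral>x. g1 x \<partial>M) - 1)"
  using weak_duality[OF assms, of mu0 mu1] by (simp add: dual_def algebra_simps)

lemma AE_hat_pos:
  assumes "0 < lam0" "0 < lam1"
  shows "AE x in M. 0 < g0_hat lam0 lam1 mu0 mu1 f0 f1 x"
    and "AE x in M. 0 < g1_hat lam0 lam1 mu0 mu1 f0 f1 x"
  using AE_stationary[OF assms, of mu0 mu1] by (auto simp: stationary_def elim: AE_mp)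

text \<open>The closed forms for the unprimed multipliers are test functions for the primed ones.
  The Lagrangian is affine in the multipliers and equals the dual value at the unprimed ones, so the
  four constraint residuals form a supergradient.\<close>

lemma dual_supergradient:
  assumes lam: "0 < lam0" "0 < lam1" and lam': "0 < lam0'" "0 < lam1'"
  shows "dual e0 e1 lam0' lam1' mu0' mu1' \<le> dual e0 e1 lam0 lam1 mu0 mu1
    + (lam0' - lam0) * (kl0 lam0 lam1 mu0 mu1 - e0) + (lam1' - lam1) * (kl1 lam0 lam1 mu0 mu1 - e1)
    + (mu0' - mu0) * (mass0 lam0 lam1 mu0 mu1 - 1) + (mu1' - mu1) * (mass1 lam0 lam1 mu0 mu1 - 1)"
  using dual_le_lagrangian[OF lam' integrable_g0_hat[OF lam] integrable_g1_hat[OF lam]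
     AE_hat_pos[OF lam] integrable_kl01[OF lam] integrable_kl0[OF lam] integrable_kl1[OF lam],
     of e0 e1 mu0' mu1' mu0 mu1] lagrangian_hat[OF lam, of mu0 mu1]
  unfolding kl01_def[symmetric] kl0_def[symmetric] kl1_def[symmetric]
    mass0_def[symmetric] mass1_def[symmetric]
  by (simp add: dual_def algebra_simps)

section \<open>Optimality and uniqueness, given multipliers\<close>

lemma D_KL_eq_integral:
  assumes "AE x in M. 0 < q x" "integrable M (\<lambda>x. ln (p x / q x) * p x)"
  shows "D_KL M p q = ereal (\<integral>x. ln (p x / q x) * p x \<partial>M)"
proof -
  have "AE x in M. q x = 0 \<longrightarrow> p x = 0" using assms(1) by eventually_elim simp
  then show ?thesis using assms(2) by (simp add: D_KL_def)
qed

lemma D_KL_hat: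
  assumes "0 < lam0" "0 < lam1"
  shows "D_KL M (g0_hat lam0 lam1 mu0 mu1 f0 f1) f0 = ereal (kl0 lam0 lam1 mu0 mu1)"
    and "D_KL M (g1_hat lam0 lam1 mu0 mu1 f0 f1) f1 = ereal (kl1 lam0 lam1 mu0 mu1)"
    and "D_KL M (g0_hat lam0 lam1 mu0 mu1 f0 f1) (g1_hat lam0 lam1 mu0 mu1 f0 f1)
      = ereal (kl01 lam0 lam1 mu0 mu1)"
  unfolding kl0_def kl1_def kl01_def using assms
  by (intro D_KL_eq_integral AE_pos0 AE_pos1 AE_hat_pos integrable_kl0 integrable_kl1
      integrable_kl01; simp)+

lemma multipliers_iff:
  "multipliers M f0 f1 e0 e1 lam0 lam1 mu0 mu1 \<longleftrightarrow> 0 < lam0 \<and> 0 < lam1 \<and>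
     mass0 lam0 lam1 mu0 mu1 = 1 \<and> mass1 lam0 lam1 mu0 mu1 = 1 \<and>
     kl0 lam0 lam1 mu0 mu1 = e0 \<and> kl1 lam0 lam1 mu0 mu1 = e1"
  unfolding multipliers_def total_mass_def mass0_def mass1_def
  using D_KL_hat by auto

lemma uncertainty_set_D:
  assumes "g \<in> uncertainty_set M f e"
  shows "integrable M g" "(\<integral>x. g x \<partial>M) = 1" "integrable M (\<lambda>x. ln (g x / f x) * g x)"
    "(\<integral>x. ln (g x / f x) * g x \<partial>M) \<le> e"
  using assms not_integrable_integral_eq[of M g]
  by (auto simp: uncertainty_set_def prob_density_def total_mass_def D_KL_def split: if_splits)

lemma feasible_hat:
  assumes "multipliers M f0 f1 e0 e1 lam0 lam1 mu0 mu1"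
  shows "feasible M f0 f1 e0 e1 (g0_hat lam0 lam1 mu0 mu1 f0 f1, g1_hat lam0 lam1 mu0 mu1 f0 f1)"
proof -
  have lam: "0 < lam0" "0 < lam1" using assms by (auto simp: multipliers_iff)
  have "AE x in M. 0 \<le> g0_hat lam0 lam1 mu0 mu1 f0 f1 x"
    "AE x in M. 0 \<le> g1_hat lam0 lam1 mu0 mu1 f0 f1 x"
    using AE_hat_pos[OF lam, of mu0 mu1] by (auto elim: AE_mp)
  then show ?thesis
    using assms lam measurable_hat[OF lam] AE_hat_pos[OF lam, of mu0 mu1]
    by (auto simp: feasible_def uncertainty_set_def prob_density_def multipliers_def)
qed

text \<open>The closed forms meet every constraint with equality, while a feasible pair has penalty
  terms that are no larger; after subtracting them, weak duality compares the objectives. Equal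
  objectives make every inequality tight, so the equality case of weak duality applies.\<close>

lemma feasible_kl_ge:
  assumes mult: "multipliers M f0 f1 e0 e1 lam0 lam1 mu0 mu1"
    and feas: "feasible M f0 f1 e0 e1 (g0, g1)"
    and finite: "D_KL M g0 g1 = ereal k"
  shows "kl01 lam0 lam1 mu0 mu1 \<le> k"
    and "k = kl01 lam0 lam1 mu0 mu1 \<Longrightarrow>
      (AE x in M. g0 x = g0_hat lam0 lam1 mu0 mu1 f0 f1 x) \<and>
      (AE x in M. g1 x = g1_hat lam0 lam1 mu0 mu1 f0 f1 x)"
proof -
  have lam: "0 < lam0" "0 < lam1" using mult by (auto simp: multipliers_iff)
  have u: "g0 \<in> uncertainty_set M f0 e0" "g1 \<in> uncertainty_set M f1 e1"
    and pos: "AE x in M. 0 < g0 x" "AE x in M. 0 < g1 x"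
    using feas by (auto simp: feasible_def)
  have k: "integrable M (\<lambda>x. ln (g0 x / g1 x) * g0 x)" "k = (\<integral>x. ln (g0 x / g1 x) * g0 x \<partial>M)"
    using finite by (auto simp: D_KL_def split: if_splits)
  note g0 = uncertainty_set_D[OF u(1)] and g1 = uncertainty_set_D[OF u(2)]
  note prems = lam g0(1) g1(1) pos k(1) g0(3) g1(3)
  have v: "kl01 lam0 lam1 mu0 mu1 + lam0 * e0 + mu0 + lam1 * e1 + mu1
      = - lam0 * mass0 lam0 lam1 mu0 mu1 - lam1 * mass1 lam0 lam1 mu0 mu1"
    using lagrangian_hat[OF lam, of mu0 mu1] mult by (simp add: multipliers_iff)
  have s: "lam0 * (\<integral>x. ln (g0 x / f0 x) * g0 x \<partial>M) \<le> lam0 * e0"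
    "lam1 * (\<integral>x. ln (g1 x / f1 x) * g1 x \<partial>M) \<le> lam1 * e1"
    using lam g0(4) g1(4) by (auto intro!: mult_left_mono)
  note w = weak_duality[OF prems, of mu0 mu1, folded k(2), unfolded g0(2) g1(2)]
  show "kl01 lam0 lam1 mu0 mu1 \<le> k" using w v s by linarith
  assume kl: "k = kl01 lam0 lam1 mu0 mu1"
  note eq = weak_duality_eq[OF prems, of mu0 mu1, folded k(2), unfolded g0(2) g1(2)]
  show "(AE x in M. g0 x = g0_hat lam0 lam1 mu0 mu1 f0 f1 x) \<and>
      (AE x in M. g1 x = g1_hat lam0 lam1 mu0 mu1 f0 f1 x)"
    by (rule eq) (use w v s kl in linarith)
qed

lemma least_favorable_hat:
  assumes mult: "multipliers M f0 f1 e0 e1 lam0 lam1 mu0 mu1"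
  shows "least_favorable M f0 f1 e0 e1
    (g0_hat lam0 lam1 mu0 mu1 f0 f1) (g1_hat lam0 lam1 mu0 mu1 f0 f1)"
proof -
  have lam: "0 < lam0" "0 < lam1" using mult by (auto simp: multipliers_iff)
  have "\<not> D_KL M g0 g1 < ereal (kl01 lam0 lam1 mu0 mu1)"
    if "feasible M f0 f1 e0 e1 (g0, g1)" for g0 g1
  proof (cases "D_KL M g0 g1 = \<infinity>")
    case False
    then obtain k where k: "D_KL M g0 g1 = ereal k" by (auto simp: D_KL_def split: if_splits)
    show ?thesis using feasible_kl_ge(1)[OF mult that k] k by simp
  qed simp
  then show ?thesis
    unfolding least_favorable_def is_arg_min_def
    using feasible_hat[OF mult] D_KL_hat(3)[OF lam] by auto
qed

text \<open>The closed forms are feasible with a finite objective, so a minimiser also has a finite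
  objective, not above theirs; \<open>feasible_kl_ge\<close> then gives equality of objectives and
  hence of densities.\<close>

lemma least_favorable_unique:
  assumes mult: "multipliers M f0 f1 e0 e1 lam0 lam1 mu0 mu1"
    and lf: "least_favorable M f0 f1 e0 e1 g0 g1"
  shows "(AE x in M. g0 x = g0_hat lam0 lam1 mu0 mu1 f0 f1 x) \<and>
      (AE x in M. g1 x = g1_hat lam0 lam1 mu0 mu1 f0 f1 x)"
proof -
  have lam: "0 < lam0" "0 < lam1" using mult by (auto simp: multipliers_iff)
  have feas: "feasible M f0 f1 e0 e1 (g0, g1)"
    and "\<not> ereal (kl01 lam0 lam1 mu0 mu1) < D_KL M g0 g1"
    using lf feasible_hat[OF mult] D_KL_hat(3)[OF lam, of mu0 mu1]
    unfolding least_favorable_def is_arg_min_def by fastforce+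
  then obtain k where k: "D_KL M g0 g1 = ereal k" "k \<le> kl01 lam0 lam1 mu0 mu1"
    by (auto simp: D_KL_def split: if_splits)
  show ?thesis
    using feasible_kl_ge[OF mult feas k(1)] k(2) by simp
qed

section \<open>Continuity of masses and divergences in the multipliers\<close>

lemma tendsto_hat_boxed:
  assumes box: "0 < c" "0 \<le> R" "\<And>n. c \<le> L0 n" "\<And>n. c \<le> L1 n" "\<And>n. \<bar>U0 n\<bar> \<le> R" "\<And>n. \<bar>U1 n\<bar> \<le> R"
    and lam: "0 < lam0" "0 < lam1"
    and lim: "L0 \<longlonglongrightarrow> lam0" "L1 \<longlonglongrightarrow> lam1" "U0 \<longlonglongrightarrow> mu0" "U1 \<longlonglongrightarrow> mu1"
  shows "(\<lambda>n. mass0 (L0 n) (L1 n) (U0 n) (U1 n)) \<longlonglongrightarrow> mass0 lam0 lam1 mu0 mu1"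
    and "(\<lambda>n. mass1 (L0 n) (L1 n) (U0 n) (U1 n)) \<longlonglongrightarrow> mass1 lam0 lam1 mu0 mu1"
    and "(\<lambda>n. kl0 (L0 n) (L1 n) (U0 n) (U1 n)) \<longlonglongrightarrow> kl0 lam0 lam1 mu0 mu1"
proof -
  have L: "0 < L0 n" "0 < L1 n" for n using box(1) box(3,4)[of n] by auto
  note [measurable] = measurable_hat[OF lam] measurable_hat[OF L]
  from hat_dominated[OF box(1,2)] obtain C where "\<forall>lam0\<ge>c. \<forall>lam1\<ge>c. \<forall>mu0 mu1.
    \<bar>mu0\<bar> \<le> R \<longrightarrow> \<bar>mu1\<bar> \<le> R \<longrightarrow>
    (AE x in M. \<bar>g0_hat lam0 lam1 mu0 mu1 f0 f1 x\<bar> \<le> C * (f0 x + f1 x) \<and>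
      \<bar>g1_hat lam0 lam1 mu0 mu1 f0 f1 x\<bar> \<le> C * (f0 x + f1 x) \<and>
      \<bar>ln (g0_hat lam0 lam1 mu0 mu1 f0 f1 x / f0 x) * g0_hat lam0 lam1 mu0 mu1 f0 f1 x\<bar>
        \<le> C * (f0 x + f1 x))" by blast
  then have dom: "AE x in M. \<bar>g0_hat (L0 n) (L1 n) (U0 n) (U1 n) f0 f1 x\<bar> \<le> C * (f0 x + f1 x) \<and>
      \<bar>g1_hat (L0 n) (L1 n) (U0 n) (U1 n) f0 f1 x\<bar> \<le> C * (f0 x + f1 x) \<and>
      \<bar>ln (g0_hat (L0 n) (L1 n) (U0 n) (U1 n) f0 f1 x / f0 x)
         * g0_hat (L0 n) (L1 n) (U0 n) (U1 n) f0 f1 x\<bar> \<le> C * (f0 x + f1 x)" for n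
    using box by blast
  have i: "integrable M (\<lambda>x. C * (f0 x + f1 x))" using integrable_f by simp
  have conv: "AE x in M.
      (\<lambda>n. g0_hat (L0 n) (L1 n) (U0 n) (U1 n) f0 f1 x) \<longlonglongrightarrow> g0_hat lam0 lam1 mu0 mu1 f0 f1 x \<and>
      (\<lambda>n. g1_hat (L0 n) (L1 n) (U0 n) (U1 n) f0 f1 x) \<longlonglongrightarrow> g1_hat lam0 lam1 mu0 mu1 f0 f1 x \<and>
      (\<lambda>n. ln (g0_hat (L0 n) (L1 n) (U0 n) (U1 n) f0 f1 x / f0 x)
         * g0_hat (L0 n) (L1 n) (U0 n) (U1 n) f0 f1 x)
       \<longlonglongrightarrow> ln (g0_hat lam0 lam1 mu0 mu1 f0 f1 x / f0 x) * g0_hat lam0 lam1 mu0 mu1 f0 f1 x"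
    using AE_stationary[OF lam, of mu0 mu1]
  proof eventually_elim
    case (elim x)
    define l where "l = f1 x / f0 x"
    let ?arg = "\<lambda>lam0 lam1 mu0 mu1. lam0 * exp ((- lam1 - lam1 * mu0 + lam0 * mu1) / ((1 + lam0) * lam1))
            * l powr (- (lam0 / (1 + lam0))) / ((1 + lam0) * lam1)"
    have f: "0 < l" using elim by (simp add: l_def)
    have pos: "0 < g0_hat lam0 lam1 mu0 mu1 f0 f1 x" using elim by (simp add: stationary_def)
    have arg: "0 < ?arg lam0 lam1 mu0 mu1" using lam f by simp
    have "(\<lambda>n. Lambert_W (?arg (L0 n) (L1 n) (U0 n) (U1 n))) \<longlonglongrightarrow> Lambert_W (?arg lam0 lam1 mu0 mu1)"
    proof (rule continuous_on_tendsto_compose[OF continuous_on_Lambert_W])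
      show "(\<lambda>n. ?arg (L0 n) (L1 n) (U0 n) (U1 n)) \<longlonglongrightarrow> ?arg lam0 lam1 mu0 mu1"
        using lam f by (intro tendsto_intros lim) auto
      show "?arg lam0 lam1 mu0 mu1 \<in> {0..}" using arg by simp
      show "\<forall>\<^sub>F n in sequentially. ?arg (L0 n) (L1 n) (U0 n) (U1 n) \<in> {0..}"
      proof (rule always_eventually, rule allI)
        fix n show "?arg (L0 n) (L1 n) (U0 n) (U1 n) \<in> {0..}" using L[of n] f by simp
      qed
    qed
    then have W: "(\<lambda>n. W_term (L0 n) (L1 n) (U0 n) (U1 n) f0 f1 x) \<longlonglongrightarrow> W_term lam0 lam1 mu0 mu1 f0 f1 x"
      by (simp add: W_term_def l_def)
    have "0 < W_term lam0 lam1 mu0 mu1 f0 f1 x"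
      unfolding W_term_def using Lambert_W_pos[OF arg] by (simp add: l_def)
    moreover have "0 < lam1 + lam1 / lam0" using lam by (intro add_pos_pos) auto
    ultimately have
      1: "(\<lambda>n. g0_hat (L0 n) (L1 n) (U0 n) (U1 n) f0 f1 x) \<longlonglongrightarrow> g0_hat lam0 lam1 mu0 mu1 f0 f1 x" and
      2: "(\<lambda>n. g1_hat (L0 n) (L1 n) (U0 n) (U1 n) f0 f1 x) \<longlonglongrightarrow> g1_hat lam0 lam1 mu0 mu1 f0 f1 x"
      unfolding g0_hat_def g1_hat_def using lam
      by (auto intro!: tendsto_intros lim W)
    have "(\<lambda>n. ln (g0_hat (L0 n) (L1 n) (U0 n) (U1 n) f0 f1 x / f0 x)
         * g0_hat (L0 n) (L1 n) (U0 n) (U1 n) f0 f1 x)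
       \<longlonglongrightarrow> ln (g0_hat lam0 lam1 mu0 mu1 f0 f1 x / f0 x) * g0_hat lam0 lam1 mu0 mu1 f0 f1 x"
      using elim pos by (intro tendsto_intros 1) auto
    with 1 2 show ?case by blast
  qed
  show "(\<lambda>n. mass0 (L0 n) (L1 n) (U0 n) (U1 n)) \<longlonglongrightarrow> mass0 lam0 lam1 mu0 mu1"
    unfolding mass0_def
    by (rule integral_dominated_convergence[OF _ _ i])
      (use conv dom in \<open>auto elim: AE_mp\<close>)
  show "(\<lambda>n. mass1 (L0 n) (L1 n) (U0 n) (U1 n)) \<longlonglongrightarrow> mass1 lam0 lam1 mu0 mu1"
    unfolding mass1_def
    by (rule integral_dominated_convergence[OF _ _ i])
      (use conv dom in \<open>auto elim: AE_mp\<close>)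
  show "(\<lambda>n. kl0 (L0 n) (L1 n) (U0 n) (U1 n)) \<longlonglongrightarrow> kl0 lam0 lam1 mu0 mu1"
    unfolding kl0_def
    by (rule integral_dominated_convergence[OF _ _ i])
      (use conv dom in \<open>auto elim: AE_mp\<close>)
qed

text \<open>A convergent sequence with limit in the open region eventually stays in a box bounded
  away from \<open>lam0 = 0\<close> and \<open>lam1 = 0\<close>, so the boxed version applies after
  dropping an initial segment.\<close>

lemma tendsto_hat:
  assumes lam: "0 < lam0" "0 < lam1"
    and lim: "L0 \<longlonglongrightarrow> lam0" "L1 \<longlonglongrightarrow> lam1" "U0 \<longlonglongrightarrow> mu0" "U1 \<longlonglongrightarrow> mu1"
  shows "(\<lambda>n. mass0 (L0 n) (L1 n) (U0 n) (U1 n)) \<longlonglongrightarrow> mass0 lam0 lam1 mu0 mu1"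
    and "(\<lambda>n. mass1 (L0 n) (L1 n) (U0 n) (U1 n)) \<longlonglongrightarrow> mass1 lam0 lam1 mu0 mu1"
    and "(\<lambda>n. kl0 (L0 n) (L1 n) (U0 n) (U1 n)) \<longlonglongrightarrow> kl0 lam0 lam1 mu0 mu1"
    and "(\<lambda>n. kl1 (L0 n) (L1 n) (U0 n) (U1 n)) \<longlonglongrightarrow> kl1 lam0 lam1 mu0 mu1"
proof -
  define c where "c = min lam0 lam1 / 2"
  define R where "R = max \<bar>mu0\<bar> \<bar>mu1\<bar> + 1"
  have c: "0 < c" "c < lam0" "c < lam1" and R: "0 \<le> R" "\<bar>mu0\<bar> < R" "\<bar>mu1\<bar> < R"
    using lam by (auto simp: c_def R_def)
  have "\<forall>\<^sub>F n in sequentially. c < L0 n \<and> c < L1 n \<and> \<bar>U0 n\<bar> < R \<and> \<bar>U1 n\<bar> < R"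
    using c R lam
    by (intro eventually_conj order_tendstoD(1)[OF lim(1)] order_tendstoD(1)[OF lim(2)]
        order_tendstoD(2)[OF tendsto_rabs[OF lim(3)]] order_tendstoD(2)[OF tendsto_rabs[OF lim(4)]])
  then obtain N where N: "\<And>n. N \<le> n \<Longrightarrow> c < L0 n \<and> c < L1 n \<and> \<bar>U0 n\<bar> < R \<and> \<bar>U1 n\<bar> < R"
    by (auto simp: eventually_sequentially)
  have box: "c \<le> L0 (n + N)" "c \<le> L1 (n + N)" "\<bar>U0 (n + N)\<bar> \<le> R" "\<bar>U1 (n + N)\<bar> \<le> R" for n
    using N[of "n + N"] by auto
  note t = tendsto_hat_boxed[OF c(1) R(1) box lam LIMSEQ_ignore_initial_segment[OF lim(1)]
      LIMSEQ_ignore_initial_segment[OF lim(2)] LIMSEQ_ignore_initial_segment[OF lim(3)]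
      LIMSEQ_ignore_initial_segment[OF lim(4)]]
  show m0: "(\<lambda>n. mass0 (L0 n) (L1 n) (U0 n) (U1 n)) \<longlonglongrightarrow> mass0 lam0 lam1 mu0 mu1"
    by (rule LIMSEQ_offset[OF t(1)])
  show m1: "(\<lambda>n. mass1 (L0 n) (L1 n) (U0 n) (U1 n)) \<longlonglongrightarrow> mass1 lam0 lam1 mu0 mu1"
    by (rule LIMSEQ_offset[OF t(2)])
  show "(\<lambda>n. kl0 (L0 n) (L1 n) (U0 n) (U1 n)) \<longlonglongrightarrow> kl0 lam0 lam1 mu0 mu1"
    by (rule LIMSEQ_offset[OF t(3)])
  have pos: "0 < L0 n" "0 < L1 n" if "N \<le> n" for n using N[OF that] c by auto
  \<comment> \<open>The divergence from \<open>f1\<close> needs no majorant of its own: it is the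
    explicit function of the masses in \<open>kl1_eq\<close>.\<close>
  have "(\<lambda>n. (mass0 (L0 n) (L1 n) (U0 n) (U1 n)
      - (L1 n + U1 n) * mass1 (L0 n) (L1 n) (U0 n) (U1 n)) / L1 n) \<longlonglongrightarrow> kl1 lam0 lam1 mu0 mu1"
    unfolding kl1_eq[OF lam] using lam by (intro tendsto_intros m0 m1 lim) auto
  then show "(\<lambda>n. kl1 (L0 n) (L1 n) (U0 n) (U1 n)) \<longlonglongrightarrow> kl1 lam0 lam1 mu0 mu1"
    by (rule Lim_transform_eventually)
      (use pos in \<open>auto simp: eventually_sequentially kl1_eq intro!: exI[of _ N]\<close>)
qed

end

section \<open>Geometric mixtures\<close>

text \<open>The factor \<open>\<delta> * \<bar>t\<bar>\<close> is absorbed into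
  \<open>exp (\<delta> * \<bar>t\<bar>)\<close>, which moves the slope \<open>s\<close> to
  \<open>s + \<delta>\<close> or \<open>s - \<delta>\<close>, still within \<open>[0, 1]\<close>.
  For \<open>t\<close> the log-likelihood ratio, multiplying the bound by \<open>f0\<close> gives
  the majorant \<open>f0 + f1\<close>.\<close>

lemma abs_mult_exp_le:
  fixes s t \<delta> :: real
  assumes "0 < \<delta>" "\<delta> \<le> s" "s + \<delta> \<le> 1"
  shows "\<delta> * \<bar>exp (s * t) * t\<bar> \<le> 1 + exp t"
proof -
  have "\<delta> * \<bar>t\<bar> \<le> exp (\<delta> * \<bar>t\<bar>)"
    using exp_ge_add_one_self[of "\<delta> * \<bar>t\<bar>"] by linarith
  then have "exp (s * t) * (\<delta> * \<bar>t\<bar>) \<le> exp (s * t) * exp (\<delta> * \<bar>t\<bar>)"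
    by (intro mult_left_mono) auto
  also have "\<dots> = exp (s * t + \<delta> * \<bar>t\<bar>)" by (simp add: exp_add)
  also have "\<dots> \<le> 1 + exp t"
  proof (cases "0 \<le> t")
    case True
    have "s * t + \<delta> * \<bar>t\<bar> = (s + \<delta>) * t" using True by (simp add: algebra_simps)
    also have "\<dots> \<le> 1 * t" using assms True by (intro mult_right_mono) auto
    finally have "exp (s * t + \<delta> * \<bar>t\<bar>) \<le> exp t" by simp
    then show ?thesis by linarith
  next
    case False
    have "s * t + \<delta> * \<bar>t\<bar> = (s - \<delta>) * t" using False by (simp add: algebra_simps)
    also have "\<dots> \<le> 0" using assms False by (intro mult_nonneg_nonpos) auto
    finally have "exp (s * t + \<delta> * \<bar>t\<bar>) \<le> 1" by simp
    then show ?thesis by (simp add: add_increasing2)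
  qed
  finally show ?thesis by (simp add: abs_mult algebra_simps)
qed

lemma exp_mult_le:
  fixes s t :: real
  assumes "0 \<le> s" "s \<le> 1"
  shows "exp (s * t) \<le> 1 + exp t"
proof (cases "0 \<le> t")
  case True
  then have "s * t \<le> 1 * t" using assms by (intro mult_right_mono) auto
  then have "exp (s * t) \<le> exp t" by simp
  then show ?thesis by linarith
next
  case False
  then have "exp (s * t) \<le> 1" using assms by (simp add: mult_nonneg_nonpos)
  then show ?thesis by (simp add: add_increasing2)
qed

context positive_densities
begin

definition llr :: "'a \<Rightarrow> real" where "llr x = ln (f1 x / f0 x)"

text \<open>Equals \<open>f0 powr (1 - s) * f1 powr s\<close> where both densities are positive. In
  this form its logarithm relative to \<open>f0\<close>, \<open>f1\<close> or another mixture is an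
  affine function of \<open>llr\<close>.\<close>

definition geo :: "real \<Rightarrow> 'a \<Rightarrow> real" where "geo s x = f0 x * exp (s * llr x)"

text \<open>The Hellinger integral, or Chernoff coefficient, of order \<open>s\<close>.\<close>

definition geo_mass :: "real \<Rightarrow> real" where "geo_mass s = (\<integral>x. geo s x \<partial>M)"

definition geo_llr :: "real \<Rightarrow> real" where "geo_llr s = (\<integral>x. geo s x * llr x \<partial>M)"

text \<open>For \<open>0 < s < 1\<close> this and \<open>geo_kl1\<close> are the divergences of the
  normalised mixture \<open>geo s / geo_mass s\<close> from \<open>f0\<close> and \<open>f1\<close>;
  see \<open>scaled_geo_kl\<close>.\<close>

definition geo_kl0 :: "real \<Rightarrow> real" where
  "geo_kl0 s = s * geo_llr s / geo_mass s - ln (geo_mass s)"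

definition geo_kl1 :: "real \<Rightarrow> real" where
  "geo_kl1 s = (s - 1) * geo_llr s / geo_mass s - ln (geo_mass s)"

lemma measurable_geo [measurable]: "llr \<in> borel_measurable M" "geo s \<in> borel_measurable M"
  unfolding llr_def[abs_def] geo_def[abs_def] by measurable

lemma geo_le:
  assumes "0 < f0 x" "0 < f1 x" "0 \<le> s" "s \<le> 1"
  shows "\<bar>geo s x\<bar> \<le> f0 x + f1 x"
proof -
  have "\<bar>geo s x\<bar> = f0 x * exp (s * llr x)" using assms by (simp add: geo_def abs_mult)
  also have "\<dots> \<le> f0 x * (1 + exp (llr x))"
    using assms by (intro mult_left_mono exp_mult_le) auto
  also have "\<dots> = f0 x + f1 x" using assms by (simp add: llr_def field_simps)
  finally show ?thesis .
qed

lemma geo_llr_le: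
  assumes "0 < f0 x" "0 < f1 x" "0 < \<delta>" "\<delta> \<le> s" "s + \<delta> \<le> 1"
  shows "\<delta> * \<bar>geo s x * llr x\<bar> \<le> f0 x + f1 x"
proof -
  have "\<delta> * \<bar>geo s x * llr x\<bar> = f0 x * (\<delta> * \<bar>exp (s * llr x) * llr x\<bar>)"
    using assms by (simp add: geo_def abs_mult)
  also have "\<dots> \<le> f0 x * (1 + exp (llr x))"
    using assms by (intro mult_left_mono abs_mult_exp_le) auto
  also have "\<dots> = f0 x + f1 x" using assms by (simp add: llr_def field_simps)
  finally show ?thesis .
qed

lemma integrable_f_sum: "integrable M (\<lambda>x. f0 x + f1 x)"
  using integrable_f by simp

lemma integrable_geo:
  assumes "0 \<le> s" "s \<le> 1"
  shows "integrable M (geo s)"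
proof (rule Bochner_Integration.integrable_bound[OF integrable_f_sum])
  show "AE x in M. norm (geo s x) \<le> norm (f0 x + f1 x)"
    using AE_pos by eventually_elim (use geo_le assms in fastforce)
qed measurable

lemma integrable_geo_llr:
  assumes "0 < s" "s < 1"
  shows "integrable M (\<lambda>x. geo s x * llr x)"
proof -
  define \<delta> where "\<delta> = min s (1 - s)"
  have \<delta>: "0 < \<delta>" "\<delta> \<le> s" "s + \<delta> \<le> 1" using assms by (auto simp: \<delta>_def min_def)
  show ?thesis
  proof (rule Bochner_Integration.integrable_bound)
    show "integrable M (\<lambda>x. (f0 x + f1 x) / \<delta>)" using integrable_f by simp
    show "AE x in M. norm (geo s x * llr x) \<le> norm ((f0 x + f1 x) / \<delta>)"
      using AE_pos
    proof eventually_elim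
      case (elim x)
      then show ?case using geo_llr_le[of x, OF _ _ \<delta>] \<delta> by (simp add: field_simps)
    qed
  qed measurable
qed

lemma geo_mass_tendsto:
  assumes s: "\<And>n. 0 \<le> S n" "\<And>n. S n \<le> 1" and lim: "S \<longlonglongrightarrow> s"
  shows "(\<lambda>n. geo_mass (S n)) \<longlonglongrightarrow> geo_mass s"
  unfolding geo_mass_def
proof (rule integral_dominated_convergence[OF _ _ integrable_f_sum])
  show "AE x in M. (\<lambda>n. geo (S n) x) \<longlonglongrightarrow> geo s x"
    unfolding geo_def by (intro AE_I2 tendsto_intros lim)
  show "AE x in M. norm (geo (S n) x) \<le> f0 x + f1 x" for n
    using AE_pos by eventually_elim (use geo_le s in simp)
qed measurable

text \<open>At \<open>s = 0\<close> and \<open>s = 1\<close> the integrand of \<open>geo_llr\<close>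
  may fail to be integrable. A factor \<open>D n\<close> not exceeding the distance of
  \<open>S n\<close> from the endpoints keeps \<open>f0 + f1\<close> as majorant. \<open>D n\<close>
  tending to 0 handles the endpoints, a constant \<open>D n\<close> the interior.\<close>

lemma scaled_geo_llr_tendsto:
  assumes s: "\<And>n. 0 < D n" "\<And>n. D n \<le> S n" "\<And>n. S n + D n \<le> 1"
    and lim: "S \<longlonglongrightarrow> s" "D \<longlonglongrightarrow> d"
  shows "(\<lambda>n. D n * geo_llr (S n)) \<longlonglongrightarrow> d * geo_llr s"
proof -
  have "(\<lambda>n. \<integral>x. D n * (geo (S n) x * llr x) \<partial>M) \<longlonglongrightarrow> (\<integral>x. d * (geo s x * llr x) \<partial>M)"
  proof (rule integral_dominated_convergence[OF _ _ integrable_f_sum])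
    show "AE x in M. (\<lambda>n. D n * (geo (S n) x * llr x)) \<longlonglongrightarrow> d * (geo s x * llr x)"
      unfolding geo_def by (intro AE_I2 tendsto_intros lim)
    show "AE x in M. norm (D n * (geo (S n) x * llr x)) \<le> f0 x + f1 x" for n
      using AE_pos
    proof eventually_elim
      case (elim x)
      then show ?case using geo_llr_le[of x "D n" "S n"] s[of n] by (simp add: abs_mult)
    qed
  qed measurable
  then show ?thesis by (simp add: geo_llr_def)
qed

lemma geo_mass_pos:
  assumes "0 \<le> s" "s \<le> 1"
  shows "0 < geo_mass s"
proof -
  have pos: "AE x in M. 0 < geo s x" using AE_pos by eventually_elim (simp add: geo_def)
  then have nn: "AE x in M. 0 \<le> geo s x" by (auto elim: AE_mp)
  have "geo_mass s \<noteq> 0"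
  proof
    assume "geo_mass s = 0"
    then have "AE x in M. geo s x = 0"
      using integral_nonneg_eq_0_iff_AE[OF integrable_geo[OF assms] nn] by (simp add: geo_mass_def)
    then have "AE x in M. f0 x = 0" using pos by eventually_elim simp
    then have "(\<integral>x. f0 x \<partial>M) = (\<integral>x. 0 \<partial>M)" by (intro integral_cong_AE) auto
    then show False using integral_f by simp
  qed
  moreover have "0 \<le> geo_mass s" unfolding geo_mass_def by (intro integral_nonneg_AE nn)
  ultimately show ?thesis by simp
qed

lemma geo_mass_0: "geo_mass 0 = 1"
  unfolding geo_mass_def geo_def using integral_f by simp

lemma geo_mass_1: "geo_mass 1 = 1"
proof -
  have "geo_mass 1 = (\<integral>x. f1 x \<partial>M)"
    unfolding geo_mass_def
  proof (rule integral_cong_AE)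
    show "AE x in M. geo 1 x = f1 x"
      using AE_pos by eventually_elim (simp add: geo_def llr_def)
  qed measurable
  then show ?thesis using integral_f by simp
qed

text \<open>Towards either endpoint the mass tends to 1, and \<open>s * geo_llr s\<close>,
  respectively \<open>(1 - s) * geo_llr s\<close>, tends to 0 even if the divergence between the
  nominal densities is infinite.\<close>

lemma geo_kl_small:
  assumes "0 < e"
  shows "\<exists>s. 0 < s \<and> s \<le> 1/2 \<and> geo_kl0 s < e" and "\<exists>s. 1/2 \<le> s \<and> s < 1 \<and> geo_kl1 s < e"
proof -
  \<comment> \<open>Starting at 1/2 lets \<open>S n\<close> serve both as distance from the endpoint
    and as scaling factor, and puts the two witnesses on opposite sides of 1/2.\<close>
  define S where "S n = 1 / real (Suc (Suc n))" for n
  have S: "0 < S n" "S n \<le> 1/2" for n by (auto simp: S_def field_simps)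
  have lim: "S \<longlonglongrightarrow> 0"
    unfolding S_def using LIMSEQ_Suc[OF LIMSEQ_inverse_real_of_nat] by (simp add: field_simps)
  have "S n \<le> S n" "S n + S n \<le> 1" "0 \<le> S n" "S n \<le> 1" for n using S[of n] by auto
  note b = this
  have "(\<lambda>n. S n * geo_llr (S n)) \<longlonglongrightarrow> 0 * geo_llr 0"
    by (rule scaled_geo_llr_tendsto[OF S(1) b(1,2) lim lim])
  moreover have "(\<lambda>n. geo_mass (S n)) \<longlonglongrightarrow> geo_mass 0"
    by (rule geo_mass_tendsto[OF b(3,4) lim])
  ultimately have "(\<lambda>n. geo_kl0 (S n)) \<longlonglongrightarrow> 0 * geo_llr 0 / geo_mass 0 - ln (geo_mass 0)"
    unfolding geo_kl0_def
    by (intro tendsto_diff tendsto_divide tendsto_ln) (auto simp: geo_mass_0)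
  then have "\<forall>\<^sub>F n in sequentially. geo_kl0 (S n) < e"
    using assms by (intro order_tendstoD(2)) (auto simp: geo_mass_0)
  then obtain n where "geo_kl0 (S n) < e" by (auto simp: eventually_sequentially)
  then show "\<exists>s. 0 < s \<and> s \<le> 1/2 \<and> geo_kl0 s < e" using S by blast
  have lim': "(\<lambda>n. 1 - S n) \<longlonglongrightarrow> 1" using tendsto_diff[OF tendsto_const lim, of 1] by simp
  have "S n \<le> 1 - S n" "1 - S n + S n \<le> 1" "0 \<le> 1 - S n" "1 - S n \<le> 1" for n using S[of n] by auto
  note b = this
  have "(\<lambda>n. S n * geo_llr (1 - S n)) \<longlonglongrightarrow> 0 * geo_llr 1"
    by (rule scaled_geo_llr_tendsto[OF S(1) b(1,2) lim' lim])
  moreover have "(\<lambda>n. geo_mass (1 - S n)) \<longlonglongrightarrow> geo_mass 1"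
    by (rule geo_mass_tendsto[OF b(3,4) lim'])
  ultimately have "(\<lambda>n. - (S n * geo_llr (1 - S n)) / geo_mass (1 - S n) - ln (geo_mass (1 - S n)))
      \<longlonglongrightarrow> - (0 * geo_llr 1) / geo_mass 1 - ln (geo_mass 1)"
    by (intro tendsto_diff tendsto_divide tendsto_ln tendsto_minus) (auto simp: geo_mass_1)
  then have "(\<lambda>n. geo_kl1 (1 - S n)) \<longlonglongrightarrow> - (0 * geo_llr 1) / geo_mass 1 - ln (geo_mass 1)"
    by (simp add: geo_kl1_def)
  then have "\<forall>\<^sub>F n in sequentially. geo_kl1 (1 - S n) < e"
    using assms by (intro order_tendstoD(2)) (auto simp: geo_mass_1)
  then obtain n where "geo_kl1 (1 - S n) < e" by (auto simp: eventually_sequentially)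
  moreover have "1/2 \<le> 1 - S n" "1 - S n < 1" using S[of n] by auto
  ultimately show "\<exists>s. 1/2 \<le> s \<and> s < 1 \<and> geo_kl1 s < e" by blast
qed

lemma continuous_on_geo_kl:
  assumes "0 < a" "b < 1"
  shows "continuous_on {a..b} geo_kl0" and "continuous_on {a..b} geo_kl1"
proof -
  define \<delta> where "\<delta> = min a (1 - b)"
  have \<delta>: "0 < \<delta>" "\<delta> \<le> a" "b + \<delta> \<le> 1" using assms by (auto simp: \<delta>_def min_def)
  have m: "continuous_on {a..b} geo_mass"
    unfolding continuous_on_sequentially o_def
  proof (intro allI ballI impI, elim conjE)
    fix S s assume S: "\<forall>n. S n \<in> {a..b}" "S \<longlonglongrightarrow> s"
    have "0 \<le> S n" "S n \<le> 1" for n using S(1)[rule_format, of n] assms by auto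
    then show "(\<lambda>n. geo_mass (S n)) \<longlonglongrightarrow> geo_mass s" by (intro geo_mass_tendsto S(2))
  qed
  \<comment> \<open>Away from the endpoints the scaling factor can be a constant, which is divided
    out afterwards.\<close>
  have v: "continuous_on {a..b} (\<lambda>s. \<delta> * geo_llr s)"
    unfolding continuous_on_sequentially o_def
  proof (intro allI ballI impI, elim conjE)
    fix S s assume S: "\<forall>n. S n \<in> {a..b}" "S \<longlonglongrightarrow> s"
    have "\<delta> \<le> S n" "S n + \<delta> \<le> 1" for n using S(1)[rule_format, of n] \<delta> by auto
    then show "(\<lambda>n. \<delta> * geo_llr (S n)) \<longlonglongrightarrow> \<delta> * geo_llr s"
      using \<delta> S by (intro scaled_geo_llr_tendsto) auto
  qed
  have "continuous_on {a..b} (\<lambda>s. (\<delta> * geo_llr s) / \<delta>)"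
    using \<delta> by (intro continuous_intros v) auto
  then have v: "continuous_on {a..b} geo_llr" using \<delta> by simp
  have "geo_mass s \<noteq> 0" "0 < geo_mass s" if "s \<in> {a..b}" for s
    using geo_mass_pos[of s] that assms by auto
  then show "continuous_on {a..b} geo_kl0" "continuous_on {a..b} geo_kl1"
    unfolding geo_kl0_def[abs_def] geo_kl1_def[abs_def]
    by (intro continuous_intros m v; auto)+
qed

section \<open>Scaled mixtures as test functions for the dual\<close>

lemma geo_linear_integral:
  assumes s: "0 < s" "s < 1" and h: "h \<in> borel_measurable M"
    and eq: "AE x in M. h x = c * (geo s x * (\<alpha> + \<beta> * llr x))"
  shows "integrable M h" and "(\<integral>x. h x \<partial>M) = c * (\<alpha> * geo_mass s + \<beta> * geo_llr s)"
proof -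
  note [measurable] = h
  have i: "integrable M (\<lambda>x. c * (\<alpha> * geo s x + \<beta> * (geo s x * llr x)))"
    using integrable_geo[of s] integrable_geo_llr[OF s] s
    by (intro integrable_mult_right Bochner_Integration.integrable_add) auto
  have eq': "AE x in M. h x = c * (\<alpha> * geo s x + \<beta> * (geo s x * llr x))"
    using eq by eventually_elim (simp add: algebra_simps)
  show "integrable M h"
    by (rule integrable_cong_AE_imp[OF i h]) (use eq' in \<open>auto elim: AE_mp\<close>)
  have "(\<integral>x. h x \<partial>M) = (\<integral>x. c * (\<alpha> * geo s x + \<beta> * (geo s x * llr x)) \<partial>M)"
    by (rule integral_cong_AE) (use eq' in auto)
  also have "\<dots> = c * (\<alpha> * geo_mass s + \<beta> * geo_llr s)"
    using integrable_geo[of s] integrable_geo_llr[OF s] s by (simp add: geo_mass_def geo_llr_def)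
  finally show "(\<integral>x. h x \<partial>M) = c * (\<alpha> * geo_mass s + \<beta> * geo_llr s)" .
qed

lemma AE_scaled_geo:
  assumes "0 < c" "0 < d"
  shows "AE x in M. ln (c * geo s x / f0 x) = ln c + s * llr x \<and>
    ln (c * geo s x / f1 x) = ln c + (s - 1) * llr x \<and>
    ln (c * geo s x / (d * geo r x)) = (ln c - ln d) + (s - r) * llr x \<and>
    0 < geo s x"
  using AE_pos by eventually_elim
    (use assms in \<open>simp add: geo_def ln_div ln_mult llr_def algebra_simps\<close>)

text \<open>The masses \<open>\<sigma>\<close> and \<open>\<tau>\<close> are left free, since test
  functions of mass different from 1 are what detects large \<open>mu0\<close> and
  \<open>mu1\<close>. Every logarithm is affine in \<open>llr\<close>, so each integral reduces to
  \<open>geo_mass s\<close> and \<open>geo_llr s\<close>.\<close>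

lemma scaled_geo_kl:
  fixes \<sigma> \<tau> :: real
  assumes s: "0 < s" "s < 1" and r: "0 < r" "r < 1" and "0 < \<sigma>" "0 < \<tau>"
  defines "c \<equiv> \<sigma> / geo_mass s" and "d \<equiv> \<tau> / geo_mass r"
  shows "integrable M (\<lambda>x. c * geo s x)" "(\<integral>x. c * geo s x \<partial>M) = \<sigma>"
    "AE x in M. 0 < c * geo s x"
    "integrable M (\<lambda>x. ln (c * geo s x / f0 x) * (c * geo s x))"
    "(\<integral>x. ln (c * geo s x / f0 x) * (c * geo s x) \<partial>M) = \<sigma> * (ln \<sigma> + geo_kl0 s)"
    "integrable M (\<lambda>x. ln (c * geo s x / f1 x) * (c * geo s x))"
    "(\<integral>x. ln (c * geo s x / f1 x) * (c * geo s x) \<partial>M) = \<sigma> * (ln \<sigma> + geo_kl1 s)"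
    "integrable M (\<lambda>x. ln (c * geo s x / (d * geo r x)) * (c * geo s x))"
    "(\<integral>x. ln (c * geo s x / (d * geo r x)) * (c * geo s x) \<partial>M) =
       \<sigma> * (ln \<sigma> - ln \<tau> + (ln (geo_mass r) - ln (geo_mass s) + (s - r) * geo_llr s / geo_mass s))"
proof -
  have m: "0 < geo_mass s" "0 < geo_mass r" using geo_mass_pos s r by auto
  have cd: "0 < c" "0 < d" using m assms by (auto simp: c_def d_def)
  have ln_c: "ln c = ln \<sigma> - ln (geo_mass s)" "ln d = ln \<tau> - ln (geo_mass r)"
    unfolding c_def d_def using m assms by (auto simp: ln_div)
  have AE: "AE x in M. ln (c * geo s x / f0 x) = ln c + s * llr x \<and>
    ln (c * geo s x / f1 x) = ln c + (s - 1) * llr x \<and>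
    ln (c * geo s x / (d * geo r x)) = (ln c - ln d) + (s - r) * llr x \<and> 0 < geo s x"
    by (rule AE_scaled_geo[OF cd])
  show "integrable M (\<lambda>x. c * geo s x)" "(\<integral>x. c * geo s x \<partial>M) = \<sigma>"
    using integrable_geo[of s] s m unfolding c_def by (auto simp: geo_mass_def)
  have vals: "c * (ln c * geo_mass s + s * geo_llr s) = \<sigma> * (ln \<sigma> + geo_kl0 s)"
    "c * (ln c * geo_mass s + (s - 1) * geo_llr s) = \<sigma> * (ln \<sigma> + geo_kl1 s)"
    "c * ((ln c - ln d) * geo_mass s + (s - r) * geo_llr s) =
       \<sigma> * (ln \<sigma> - ln \<tau> + (ln (geo_mass r) - ln (geo_mass s) + (s - r) * geo_llr s / geo_mass s))"
    unfolding geo_kl0_def geo_kl1_def ln_c using m by (auto simp: c_def field_simps)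
  show "AE x in M. 0 < c * geo s x" using AE by eventually_elim (use cd in simp)
  have "AE x in M. ln (c * geo s x / f0 x) * (c * geo s x) = c * (geo s x * (ln c + s * llr x))"
    using AE by eventually_elim simp
  from geo_linear_integral[OF s _ this]
  show "integrable M (\<lambda>x. ln (c * geo s x / f0 x) * (c * geo s x))"
    "(\<integral>x. ln (c * geo s x / f0 x) * (c * geo s x) \<partial>M) = \<sigma> * (ln \<sigma> + geo_kl0 s)"
    unfolding vals by auto
  have "AE x in M. ln (c * geo s x / f1 x) * (c * geo s x) = c * (geo s x * (ln c + (s - 1) * llr x))"
    using AE by eventually_elim simp
  from geo_linear_integral[OF s _ this]
  show "integrable M (\<lambda>x. ln (c * geo s x / f1 x) * (c * geo s x))"
    "(\<integral>x. ln (c * geo s x / f1 x) * (c * geo s x) \<partial>M) = \<sigma> * (ln \<sigma> + geo_kl1 s)"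
    unfolding vals by auto
  have "AE x in M. ln (c * geo s x / (d * geo r x)) * (c * geo s x)
      = c * (geo s x * ((ln c - ln d) + (s - r) * llr x))"
    using AE by eventually_elim simp
  from geo_linear_integral[OF s _ this]
  show "integrable M (\<lambda>x. ln (c * geo s x / (d * geo r x)) * (c * geo s x))"
    "(\<integral>x. ln (c * geo s x / (d * geo r x)) * (c * geo s x) \<partial>M) =
       \<sigma> * (ln \<sigma> - ln \<tau> + (ln (geo_mass r) - ln (geo_mass s) + (s - r) * geo_llr s / geo_mass s))"
    unfolding vals by auto
qed

lemma dual_le_geo:
  assumes lam: "0 < lam0" "0 < lam1"
    and s: "0 < s" "s < 1" and r: "0 < r" "r < 1" and \<sigma>: "0 < \<sigma>" and \<tau>: "0 < \<tau>"
  shows "dual e0 e1 lam0 lam1 mu0 mu1 \<le>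
     \<sigma> * (ln \<sigma> - ln \<tau> + (ln (geo_mass r) - ln (geo_mass s) + (s - r) * geo_llr s / geo_mass s))
     + lam0 * (\<sigma> * (ln \<sigma> + geo_kl0 s) - e0) + mu0 * (\<sigma> - 1)
     + lam1 * (\<tau> * (ln \<tau> + geo_kl1 r) - e1) + mu1 * (\<tau> - 1)"
proof -
  note a = scaled_geo_kl[OF s r \<sigma> \<tau>] and b = scaled_geo_kl[OF r s \<tau> \<sigma>]
  show ?thesis
    using dual_le_lagrangian[OF lam a(1) b(1) a(3) b(3) a(8) a(4) b(6), of e0 e1 mu0 mu1]
    unfolding a(2) b(2) a(5) a(9) b(7) .
qed

section \<open>Mixtures and disjoint uncertainty sets\<close>

lemma geo_in_uncertainty_set:
  assumes s: "0 < s" "s < 1"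
  shows "geo_kl0 s \<le> e \<Longrightarrow> (\<lambda>x. 1 / geo_mass s * geo s x) \<in> uncertainty_set M f0 e"
    and "geo_kl1 s \<le> e \<Longrightarrow> (\<lambda>x. 1 / geo_mass s * geo s x) \<in> uncertainty_set M f1 e"
proof -
  note a = scaled_geo_kl[OF s s zero_less_one zero_less_one]
  have "AE x in M. 0 \<le> 1 / geo_mass s * geo s x" using a(3) by eventually_elim simp
  then have pd: "prob_density M (\<lambda>x. 1 / geo_mass s * geo s x)"
    unfolding prob_density_def total_mass_def using a(2) by auto
  show "geo_kl0 s \<le> e \<Longrightarrow> (\<lambda>x. 1 / geo_mass s * geo s x) \<in> uncertainty_set M f0 e"
    using pd D_KL_eq_integral[OF AE_pos0 a(4)] a(5) by (simp add: uncertainty_set_def)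
  show "geo_kl1 s \<le> e \<Longrightarrow> (\<lambda>x. 1 / geo_mass s * geo s x) \<in> uncertainty_set M f1 e"
    using pd D_KL_eq_integral[OF AE_pos1 a(6)] a(7) by (simp add: uncertainty_set_def)
qed

text \<open>Disjointness makes every mixture violate a constraint. Near \<open>f0\<close> it must be
  the second, near \<open>f1\<close> the first, so the difference \<open>h\<close> of the two
  excesses changes sign. At a zero of \<open>h\<close> the excesses agree, and as one is positive,
  both are.\<close>

lemma disjoint_geo_crossing:
  assumes disj: "uncertainty_set M f0 e0 \<inter> uncertainty_set M f1 e1 = {}" and e: "0 < e0" "0 < e1"
  shows "\<exists>s. 0 < s \<and> s < 1 \<and> e0 < geo_kl0 s \<and> e1 < geo_kl1 s"
proof -
  have or: "e0 < geo_kl0 s \<or> e1 < geo_kl1 s" if "0 < s" "s < 1" for s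
    using disj geo_in_uncertainty_set[OF that] by (meson disjoint_iff not_less)
  obtain a where a: "0 < a" "a \<le> 1/2" "geo_kl0 a < e0" using geo_kl_small(1)[OF e(1)] by blast
  obtain b where b: "1/2 \<le> b" "b < 1" "geo_kl1 b < e1" using geo_kl_small(2)[OF e(2)] by blast
  define h where "h s = (geo_kl0 s - e0) - (geo_kl1 s - e1)" for s
  have "h a \<le> 0" using or[of a] a by (auto simp: h_def)
  moreover have "0 \<le> h b" using or[of b] b by (auto simp: h_def)
  moreover have "continuous_on {a..b} h"
    unfolding h_def using a b by (intro continuous_intros continuous_on_geo_kl)
  ultimately obtain s where s: "a \<le> s" "s \<le> b" "h s = 0"
    using IVT'[of h a 0 b] a b by auto
  have "0 < s" "s < 1" using s a b by auto
  then show ?thesis using or[of s] s(3) unfolding h_def by (intro exI[of _ s]) auto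
qed

end

section \<open>Existence of multipliers\<close>

text \<open>The multipliers lie at distance \<open>t\<close> along the direction
  \<open>(1 - s, s, 0, m)\<close> from \<open>(0, 0, -1, 1)\<close>. At that base point the
  equations say only \<open>p = q\<close>; eliminating \<open>p\<close> leaves a scalar equation for
  \<open>v\<close> whose sides are both 1 at \<open>t = 0\<close>, so that its content lies in the
  first order in \<open>t\<close>.\<close>

lemma small_multiplier_v:
  assumes st: "stationary lam0 lam1 (- 1) (1 + t * m) a b p q"
    and lam: "lam0 = t * (1 - s)" "lam1 = t * s" and pos: "0 < t" "0 < s" "s < 1" "0 < a" "0 < b"
  defines "v \<equiv> ln (q / a) + 1"
  shows "q = a * exp (v - 1)" and "p = a * exp (v / (1 + lam0) - 1)"
    and "exp (- (lam0 / (1 + lam0) * v)) = 1 + t * (s * (v - ln (b / a)) + m)"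
proof -
  have pq: "0 < p" "0 < q" using st by (auto simp: stationary_def)
  have l0: "0 < lam0" using lam pos by simp
  show q: "q = a * exp (v - 1)" using pq pos by (simp add: v_def)
  have "(1 + lam0) * ln (p / a) = v - (1 + lam0)"
    using st by (simp add: stationary_def v_def)
  then have "ln (p / a) = (v - (1 + lam0)) / (1 + lam0)"
    using l0 by (simp add: field_simps)
  also have "\<dots> = v / (1 + lam0) - 1" using l0 by (simp add: diff_divide_distrib)
  finally have "p / a = exp (v / (1 + lam0) - 1)"
    using pq pos by (metis divide_pos_pos exp_ln)
  then show p: "p = a * exp (v / (1 + lam0) - 1)" using pos by (simp add: field_simps)
  have "p / q = exp ((v / (1 + lam0) - 1) - (v - 1))"
    unfolding exp_diff using pos by (simp add: p q exp_diff)
  also have "(v / (1 + lam0) - 1) - (v - 1) = - (lam0 / (1 + lam0) * v)"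
    using l0 by (simp add: field_simps)
  finally have "exp (- (lam0 / (1 + lam0) * v)) = p / q" ..
  also have "\<dots> = lam1 * (ln (q / b) + 1) + (1 + t * m)"
    using st by (simp add: stationary_def)
  also have "ln (q / b) + 1 = v - ln (b / a)"
    using pq pos by (simp add: v_def ln_div)
  finally show "exp (- (lam0 / (1 + lam0) * v)) = 1 + t * (s * (v - ln (b / a)) + m)"
    by (simp add: lam algebra_simps)
qed

text \<open>A majorant that does not depend on \<open>t\<close>. If \<open>v > 0\<close>, the left
  side of the scalar equation is below 1, which forces \<open>s * (v - ln (b / a)) + m < 0\<close>
  and bounds \<open>exp v\<close>; the positive part \<open>u\<close> of \<open>v\<close> dominates
  the exponents of both \<open>p\<close> and \<open>q\<close>.\<close>

lemma small_multiplier_bound: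
  assumes st: "stationary (t * (1 - s)) (t * s) (- 1) (1 + t * m) a b p q"
    and pos: "0 < t" "0 < s" "s < 1" "0 < a" "0 < b"
  shows "\<bar>p\<bar> \<le> a + exp (- m / s) * b" and "\<bar>q\<bar> \<le> a + exp (- m / s) * b"
proof -
  define lam0 where "lam0 = t * (1 - s)"
  define v where "v = ln (q / a) + 1"
  have pq: "0 < p" "0 < q" using st by (auto simp: stationary_def)
  have l0: "0 < lam0" using pos by (simp add: lam0_def)
  note v = small_multiplier_v[OF st refl refl pos, folded lam0_def v_def]
  define u where "u = max 0 v"
  have "exp u \<le> 1 + exp (- m / s) * b / a"
  proof (cases "0 < v")
    case True
    have "exp (- (lam0 / (1 + lam0) * v)) < 1"
      using True l0 by simp
    then have "t * (s * (v - ln (b / a)) + m) < 0" using v(3) by linarith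
    then have "s * (v - ln (b / a)) + m < 0" using pos by (simp add: mult_less_0_iff)
    then have "v < ln (b / a) + (- m / s)" using pos by (simp add: field_simps)
    then have "exp v < exp (ln (b / a) + (- m / s))" by simp
    also have "\<dots> = exp (- m / s) * b / a" unfolding exp_add using pos by simp
    finally show ?thesis using True by (simp add: u_def)
  next
    case False
    then show ?thesis using pos by (simp add: u_def)
  qed
  then have "a * exp u \<le> a * (1 + exp (- m / s) * b / a)" using pos by (intro mult_left_mono) auto
  also have "\<dots> = a + exp (- m / s) * b" using pos by (simp add: field_simps)
  finally have u: "a * exp u \<le> a + exp (- m / s) * b" .
  have "q \<le> a * exp u" unfolding v(1) using pos by (intro mult_left_mono) (auto simp: u_def)
  then show "\<bar>q\<bar> \<le> a + exp (- m / s) * b" using u pq by simp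
  have "v / (1 + lam0) \<le> u / (1 + lam0)" using l0 by (intro divide_right_mono) (auto simp: u_def)
  also have "\<dots> \<le> u / 1" using l0 by (intro divide_left_mono) (auto simp: u_def)
  finally have "p \<le> a * exp u" unfolding v(2) using pos by (intro mult_left_mono) auto
  then show "\<bar>p\<bar> \<le> a + exp (- m / s) * b" using u pq by simp
qed

text \<open>To first order the scalar equation reads
  \<open>- (1 - s) * v = s * (v - ln (b / a)) + m\<close>, with solution \<open>v0\<close>. Both
  limits are \<open>exp (- m - 1)\<close> times the geometric mixture of \<open>a\<close> and
  \<open>b\<close>.\<close>

lemma small_multiplier_tendsto:
  fixes t :: "nat \<Rightarrow> real"
  assumes st: "\<And>n. stationary (t n * (1 - s)) (t n * s) (- 1) (1 + t n * m) a b (p n) (q n)"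
    and t: "\<And>n. 0 < t n" "t \<longlonglongrightarrow> 0" and pos: "0 < s" "s < 1" "0 < a" "0 < b"
  shows "p \<longlonglongrightarrow> a * exp (s * ln (b / a) - m - 1)" and "q \<longlonglongrightarrow> a * exp (s * ln (b / a) - m - 1)"
proof -
  define lam0 where "lam0 n = t n * (1 - s)" for n
  define v where "v n = ln (q n / a) + 1" for n
  define v0 where "v0 = s * ln (b / a) - m"
  have l0: "0 < lam0 n" for n using pos t by (simp add: lam0_def)
  note v = small_multiplier_v[OF st refl refl t(1) pos, folded lam0_def v_def]
  \<comment> \<open>\<open>v n\<close> is the zero of the decreasing function \<open>F n\<close>, and \<open>F n\<close> tends to \<open>\<lambda>w. v0 - w\<close>.\<close>
  define F where "F n w = (exp (- (lam0 n / (1 + lam0 n) * w)) - 1) / t n - (s * (w - ln (b / a)) + m)"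
    for n w
  have F0: "F n (v n) = 0" for n
    unfolding F_def v(3) using t(1)[of n] by simp
  have mono: "F n w' \<le> F n w" if "w \<le> w'" for n w w'
  proof -
    have "lam0 n / (1 + lam0 n) * w \<le> lam0 n / (1 + lam0 n) * w'"
      using that l0[of n] by (intro mult_left_mono) auto
    then have "(exp (- (lam0 n / (1 + lam0 n) * w')) - 1) / t n
        \<le> (exp (- (lam0 n / (1 + lam0 n) * w)) - 1) / t n"
      using t(1)[of n] by (intro divide_right_mono) auto
    moreover have "s * (w - ln (b / a)) \<le> s * (w' - ln (b / a))"
      using that pos by (intro mult_left_mono) auto
    ultimately show ?thesis by (simp add: F_def)
  qed
  have F: "(\<lambda>n. F n w) \<longlonglongrightarrow> v0 - w" for w
  proof -
    \<comment> \<open>The first term of \<open>F n w\<close> is the difference quotient of this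
      function at 0 with increment \<open>t n\<close>.\<close>
    let ?f = "\<lambda>h. exp (- (h * (1 - s) / (1 + h * (1 - s)) * w))"
    have "(?f has_real_derivative - ((1 - s) * w)) (at 0)"
      by (auto intro!: derivative_eq_intros)
    then have "((\<lambda>h. (?f h - 1) / h) \<longlongrightarrow> - ((1 - s) * w)) (at 0)"
      by (simp add: has_field_derivative_iff)
    moreover have "filterlim t (at 0) sequentially"
      unfolding filterlim_at using t(2) t(1)[THEN less_imp_neq] by (auto intro!: always_eventually)
    ultimately have "(\<lambda>n. (?f (t n) - 1) / t n) \<longlonglongrightarrow> - ((1 - s) * w)"
      by (rule filterlim_compose)
    then have "(\<lambda>n. F n w) \<longlonglongrightarrow> - ((1 - s) * w) - (s * (w - ln (b / a)) + m)"
      unfolding F_def lam0_def by (intro tendsto_diff tendsto_const)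
    then show ?thesis by (simp add: v0_def algebra_simps)
  qed
  have lim: "v \<longlonglongrightarrow> v0"
  proof (rule order_tendstoI)
    fix w assume "w < v0"
    then have "\<forall>\<^sub>F n in sequentially. 0 < F n w" using F[of w] by (intro order_tendstoD(1)) auto
    then show "\<forall>\<^sub>F n in sequentially. w < v n"
    proof eventually_elim
      case (elim n)
      then show ?case using mono[of "v n" w n] F0[of n] by (cases "w < v n") auto
    qed
  next
    fix w assume "v0 < w"
    then have "\<forall>\<^sub>F n in sequentially. F n w < 0" using F[of w] by (intro order_tendstoD(2)) auto
    then show "\<forall>\<^sub>F n in sequentially. v n < w"
    proof eventually_elim
      case (elim n)
      then show ?case using mono[of w "v n" n] F0[of n] by (cases "v n < w") auto
    qed
  qed
  have "lam0 \<longlonglongrightarrow> 0 * (1 - s)" unfolding lam0_def[abs_def] by (intro tendsto_intros t)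
  then have "(\<lambda>n. a * exp (v n / (1 + lam0 n) - 1)) \<longlonglongrightarrow> a * exp (v0 / (1 + 0 * (1 - s)) - 1)"
    by (intro tendsto_mult tendsto_const tendsto_exp tendsto_diff tendsto_divide tendsto_add lim) auto
  then show "p \<longlonglongrightarrow> a * exp (s * ln (b / a) - m - 1)"
    unfolding v(2)[symmetric] by (simp add: v0_def)
  have "(\<lambda>n. a * exp (v n - 1)) \<longlonglongrightarrow> a * exp (v0 - 1)"
    by (intro tendsto_mult tendsto_const tendsto_exp tendsto_diff lim)
  then show "q \<longlonglongrightarrow> a * exp (s * ln (b / a) - m - 1)"
    unfolding v(1)[symmetric] by (simp add: v0_def)
qed

text \<open>\<open>\<sigma> * (ln \<sigma> + K)\<close> is the divergence integral of a density of
  divergence \<open>K\<close> rescaled to mass \<open>\<sigma>\<close>. A strict inequality at mass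
  1 persists, with a uniform margin, for nearby masses.\<close>

lemma mult_ln_slack:
  fixes K e :: real
  assumes "K < e"
  shows "\<exists>h>0. \<exists>\<eta>>0. \<forall>\<sigma>. \<bar>\<sigma> - 1\<bar> \<le> h \<longrightarrow> \<sigma> * (ln \<sigma> + K) - e \<le> - \<eta>"
proof -
  define \<eta> where "\<eta> = (e - K) / 2"
  have \<eta>: "0 < \<eta>" using assms by (simp add: \<eta>_def)
  have "((\<lambda>\<sigma>. \<sigma> * (ln \<sigma> + K)) \<longlongrightarrow> 1 * (ln 1 + K)) (nhds 1)"
    by (intro tendsto_intros) (auto simp: filterlim_ident)
  then have "\<forall>\<^sub>F \<sigma> in nhds 1. \<sigma> * (ln \<sigma> + K) < e - \<eta>"
    by (rule order_tendstoD(2)) (use assms in \<open>simp add: \<eta>_def field_simps\<close>)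
  then obtain d where d: "0 < d" "\<And>\<sigma>. dist \<sigma> 1 < d \<Longrightarrow> \<sigma> * (ln \<sigma> + K) < e - \<eta>"
    by (auto simp: eventually_nhds_metric)
  have "\<forall>\<sigma>. \<bar>\<sigma> - 1\<bar> \<le> d / 2 \<longrightarrow> \<sigma> * (ln \<sigma> + K) - e \<le> - \<eta>"
  proof (intro allI impI)
    fix \<sigma> assume "\<bar>\<sigma> - 1\<bar> \<le> d / 2"
    then show "\<sigma> * (ln \<sigma> + K) - e \<le> - \<eta>"
      using d(2)[of \<sigma>] d(1) by (simp add: dist_real_def)
  qed
  then show ?thesis using d(1) \<eta> by (intro exI[of _ "d / 2"] conjI exI[of _ \<eta>]) auto
qed

context positive_densities
begin

section \<open>Positive values, superlevel sets and maximum of the dual function\<close>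

lemma dual_positive:
  assumes s: "0 < s" "s < 1" and e: "e0 < geo_kl0 s" "e1 < geo_kl1 s"
  shows "\<exists>lam0 lam1 mu0 mu1. 0 < lam0 \<and> 0 < lam1 \<and> 0 < dual e0 e1 lam0 lam1 mu0 mu1"
proof -
  define Z where "Z = geo_mass s"
  \<comment> \<open>With this \<open>m\<close> the factor \<open>exp (- m - 1)\<close> is
    \<open>1 / Z\<close>, so both closed forms converge to the normalised mixture and both masses to
    1.\<close>
  define m where "m = ln Z - 1"
  define t where "t n = 1 / real (Suc n)" for n
  have Z: "0 < Z" using geo_mass_pos[of s] s by (simp add: Z_def)
  have t: "0 < t n" for n by (simp add: t_def)
  have t0: "t \<longlonglongrightarrow> 0" unfolding t_def[abs_def] using LIMSEQ_inverse_real_of_nat by (simp add: divide_inverse)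
  have lam: "0 < t n * (1 - s)" "0 < t n * s" for n using t s by auto
  note [measurable] = measurable_hat[OF lam]
  have gap: "(1 - s) * e0 + s * e1 < - ln Z"
  proof -
    have "(1 - s) * e0 < (1 - s) * geo_kl0 s" "s * e1 < s * geo_kl1 s" using s e by auto
    \<comment> \<open>With weights \<open>1 - s\<close> and \<open>s\<close> the
      \<open>geo_llr\<close> terms cancel.\<close>
    moreover have "(1 - s) * geo_kl0 s + s * geo_kl1 s = - ln Z"
      using Z by (simp add: geo_kl0_def geo_kl1_def Z_def field_simps)
    ultimately show ?thesis by linarith
  qed
  have i: "integrable M (\<lambda>x. f0 x + exp (- m / s) * f1 x)" using integrable_f by simp
  \<comment> \<open>Pointwise convergence needs stationarity along the whole sequence, hence one
    null set for all \<open>n\<close>.\<close>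
  have st: "AE x in M. \<forall>n. 0 < f0 x \<and> 0 < f1 x \<and>
    stationary (t n * (1 - s)) (t n * s) (- 1) (1 + t n * m) (f0 x) (f1 x)
      (g0_hat (t n * (1 - s)) (t n * s) (- 1) (1 + t n * m) f0 f1 x)
      (g1_hat (t n * (1 - s)) (t n * s) (- 1) (1 + t n * m) f0 f1 x)"
    unfolding AE_all_countable by (intro allI AE_stationary lam)
  have lim_eq: "a * exp (s * ln (b / a) - m - 1) = a * exp (s * ln (b / a)) / Z" for a b
    using Z by (simp add: m_def exp_diff)
  have one: "(\<integral>x. f0 x * exp (s * ln (f1 x / f0 x)) / Z \<partial>M) = 1"
    using Z by (simp add: Z_def geo_mass_def geo_def llr_def)
  have "(\<lambda>n. mass0 (t n * (1 - s)) (t n * s) (- 1) (1 + t n * m)) \<longlonglongrightarrow>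
      (\<integral>x. f0 x * exp (s * ln (f1 x / f0 x)) / Z \<partial>M)"
    unfolding mass0_def
  proof (rule integral_dominated_convergence[OF _ _ i])
    show "AE x in M. (\<lambda>n. g0_hat (t n * (1 - s)) (t n * s) (- 1) (1 + t n * m) f0 f1 x)
        \<longlonglongrightarrow> f0 x * exp (s * ln (f1 x / f0 x)) / Z"
      using st
    proof eventually_elim
      case (elim x)
      then show ?case
        unfolding lim_eq[symmetric] by (intro small_multiplier_tendsto(1)[OF _ t t0 s]) auto
    qed
    show "AE x in M. norm (g0_hat (t n * (1 - s)) (t n * s) (- 1) (1 + t n * m) f0 f1 x)
        \<le> f0 x + exp (- m / s) * f1 x" for n
      using st
    proof eventually_elim
      case (elim x)
      then show ?case
        unfolding real_norm_def by (intro small_multiplier_bound(1)[OF _ t[of n] s]) auto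
    qed
  qed measurable
  then have m0: "(\<lambda>n. mass0 (t n * (1 - s)) (t n * s) (- 1) (1 + t n * m)) \<longlonglongrightarrow> 1" by (simp only: one)
  have "(\<lambda>n. mass1 (t n * (1 - s)) (t n * s) (- 1) (1 + t n * m)) \<longlonglongrightarrow>
      (\<integral>x. f0 x * exp (s * ln (f1 x / f0 x)) / Z \<partial>M)"
    unfolding mass1_def
  proof (rule integral_dominated_convergence[OF _ _ i])
    show "AE x in M. (\<lambda>n. g1_hat (t n * (1 - s)) (t n * s) (- 1) (1 + t n * m) f0 f1 x)
        \<longlonglongrightarrow> f0 x * exp (s * ln (f1 x / f0 x)) / Z"
      using st
    proof eventually_elim
      case (elim x)
      then show ?case
        unfolding lim_eq[symmetric] by (intro small_multiplier_tendsto(2)[OF _ t t0 s]) auto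
    qed
    show "AE x in M. norm (g1_hat (t n * (1 - s)) (t n * s) (- 1) (1 + t n * m) f0 f1 x)
        \<le> f0 x + exp (- m / s) * f1 x" for n
      using st
    proof eventually_elim
      case (elim x)
      then show ?case
        unfolding real_norm_def by (intro small_multiplier_bound(2)[OF _ t[of n] s]) auto
    qed
  qed measurable
  then have m1: "(\<lambda>n. mass1 (t n * (1 - s)) (t n * s) (- 1) (1 + t n * m)) \<longlonglongrightarrow> 1" by (simp only: one)
  have "(\<lambda>n. - (1 - s) * mass0 (t n * (1 - s)) (t n * s) (- 1) (1 + t n * m)
      - s * mass1 (t n * (1 - s)) (t n * s) (- 1) (1 + t n * m) - (1 - s) * e0 - s * e1 - m)
      \<longlonglongrightarrow> - (1 - s) * 1 - s * 1 - (1 - s) * e0 - s * e1 - m"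
    by (intro tendsto_intros m0 m1)
  then have "\<forall>\<^sub>F n in sequentially. 0 < - (1 - s) * mass0 (t n * (1 - s)) (t n * s) (- 1) (1 + t n * m)
      - s * mass1 (t n * (1 - s)) (t n * s) (- 1) (1 + t n * m) - (1 - s) * e0 - s * e1 - m"
    by (rule order_tendstoD(1)) (use gap in \<open>simp add: m_def\<close>)
  then obtain n where n: "0 < - (1 - s) * mass0 (t n * (1 - s)) (t n * s) (- 1) (1 + t n * m)
      - s * mass1 (t n * (1 - s)) (t n * s) (- 1) (1 + t n * m) - (1 - s) * e0 - s * e1 - m"
    by (auto simp: eventually_sequentially)
  \<comment> \<open>As \<open>mu0 + mu1 = t n * m\<close>, a factor \<open>t n\<close> splits off;
    the bracket tends to \<open>- ln Z - (1 - s) * e0 - s * e1\<close>, which is positive by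
    \<open>gap\<close>.\<close>
  have "dual e0 e1 (t n * (1 - s)) (t n * s) (- 1) (1 + t n * m) =
    t n * (- (1 - s) * mass0 (t n * (1 - s)) (t n * s) (- 1) (1 + t n * m)
      - s * mass1 (t n * (1 - s)) (t n * s) (- 1) (1 + t n * m) - (1 - s) * e0 - s * e1 - m)"
    unfolding dual_def by (simp add: algebra_simps)
  then have "0 < dual e0 e1 (t n * (1 - s)) (t n * s) (- 1) (1 + t n * m)"
    using mult_pos_pos[OF t n] by simp
  then show ?thesis using lam by blast
qed

text \<open>Lower bounds on \<open>lam0\<close> and \<open>lam1\<close> come from pairs of equal
  mixtures, for which the objective is 0. The upper bounds are a Slater argument: the mixtures at
  \<open>a\<close> and \<open>b\<close> lie strictly inside the first and second uncertainty set, so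
  large \<open>lam0\<close> or \<open>lam1\<close> lowers the Lagrangian, and perturbed masses do
  the same for \<open>mu0\<close> and \<open>mu1\<close>.\<close>

lemma dual_superlevel_bounded:
  assumes e: "0 < e0" "0 < e1" and \<delta>: "0 < \<delta>"
  shows "\<exists>c R. 0 < c \<and> (\<forall>lam0 lam1 mu0 mu1. 0 < lam0 \<longrightarrow> 0 < lam1 \<longrightarrow>
    \<delta> \<le> dual e0 e1 lam0 lam1 mu0 mu1 \<longrightarrow>
    c \<le> lam0 \<and> c \<le> lam1 \<and> lam0 \<le> R \<and> lam1 \<le> R \<and> \<bar>mu0\<bar> \<le> R \<and> \<bar>mu1\<bar> \<le> R)"
proof -
  obtain a where a: "0 < a" "a \<le> 1/2" "geo_kl0 a < e0" using geo_kl_small(1)[OF e(1)] by blast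
  obtain b where b: "1/2 \<le> b" "b < 1" "geo_kl1 b < e1" using geo_kl_small(2)[OF e(2)] by blast
  have ab: "a < 1" "0 < b" using a b by auto
  obtain h0 \<eta>0 where 0: "0 < h0" "0 < \<eta>0"
    "\<And>\<sigma>. \<bar>\<sigma> - 1\<bar> \<le> h0 \<Longrightarrow> \<sigma> * (ln \<sigma> + geo_kl0 a) - e0 \<le> - \<eta>0"
    using mult_ln_slack[OF a(3)] by blast
  obtain h1 \<eta>1 where 1: "0 < h1" "0 < \<eta>1"
    "\<And>\<sigma>. \<bar>\<sigma> - 1\<bar> \<le> h1 \<Longrightarrow> \<sigma> * (ln \<sigma> + geo_kl1 b) - e1 \<le> - \<eta>1"
    using mult_ln_slack[OF b(3)] by blast
  define h where "h = min (1/2) (min h0 h1)"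
  have h: "0 < h" "h \<le> 1/2" "h \<le> h0" "h \<le> h1" using 0 1 by (auto simp: h_def)
  define J where "J \<sigma> \<tau> = \<sigma> * (ln \<sigma> - ln \<tau>
    + (ln (geo_mass b) - ln (geo_mass a) + (a - b) * geo_llr a / geo_mass a))" for \<sigma> \<tau> :: real
  \<comment> \<open>Bounds the objective for all four sign patterns of
    \<open>(mu0, mu1)\<close>.\<close>
  define C where "C = \<bar>J (1 - h) (1 - h)\<bar> + \<bar>J (1 - h) (1 + h)\<bar> + \<bar>J (1 + h) (1 - h)\<bar> + \<bar>J (1 + h) (1 + h)\<bar>"
  define A0 where "A0 = \<bar>geo_kl0 b - e0\<bar> + 1"
  define A1 where "A1 = \<bar>geo_kl1 a - e1\<bar> + 1"
  define c where "c = min (\<delta> / A0) (\<delta> / A1)"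
  define R where "R = C / \<eta>0 + C / \<eta>1 + C / h"
  have A: "0 < A0" "0 < A1" by (auto simp: A0_def A1_def)
  have C: "0 \<le> C" by (simp add: C_def)
  have "c \<le> lam0 \<and> c \<le> lam1 \<and> lam0 \<le> R \<and> lam1 \<le> R \<and> \<bar>mu0\<bar> \<le> R \<and> \<bar>mu1\<bar> \<le> R"
    if lam: "0 < lam0" "0 < lam1" and D: "\<delta> \<le> dual e0 e1 lam0 lam1 mu0 mu1" for lam0 lam1 mu0 mu1
  proof -
    \<comment> \<open>The mixture at \<open>b\<close> in both places, with mass 1: the objective and
      the mass terms vanish. The second summand is negative, so the first alone must reach
      \<open>\<delta>\<close>.\<close>
    have "\<delta> \<le> lam0 * (geo_kl0 b - e0) + lam1 * (geo_kl1 b - e1)"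
      using dual_le_geo[OF lam ab(2) b(2) ab(2) b(2) zero_less_one zero_less_one, of e0 e1 mu0 mu1] D
      by simp
    moreover have "lam1 * (geo_kl1 b - e1) \<le> 0" using lam b by (intro mult_nonneg_nonpos) auto
    moreover have "lam0 * (geo_kl0 b - e0) \<le> lam0 * A0"
      using lam by (intro mult_left_mono) (auto simp: A0_def)
    ultimately have "\<delta> / A0 \<le> lam0" using A by (simp add: pos_divide_le_eq)
    then have l0: "c \<le> lam0" by (simp add: c_def)
    have "\<delta> \<le> lam0 * (geo_kl0 a - e0) + lam1 * (geo_kl1 a - e1)"
      using dual_le_geo[OF lam a(1) ab(1) a(1) ab(1) zero_less_one zero_less_one, of e0 e1 mu0 mu1] D
      by simp
    moreover have "lam0 * (geo_kl0 a - e0) \<le> 0" using lam a by (intro mult_nonneg_nonpos) auto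
    moreover have "lam1 * (geo_kl1 a - e1) \<le> lam1 * A1"
      using lam by (intro mult_left_mono) (auto simp: A1_def)
    ultimately have "\<delta> / A1 \<le> lam1" using A by (simp add: pos_divide_le_eq)
    then have l1: "c \<le> lam1" by (simp add: c_def)
    \<comment> \<open>The mass is moved against the sign of the multiplier, so the mass term becomes
      a penalty proportional to its absolute value.\<close>
    define \<sigma> where "\<sigma> = (if 0 \<le> mu0 then 1 - h else 1 + h)"
    define \<tau> where "\<tau> = (if 0 \<le> mu1 then 1 - h else 1 + h)"
    have \<sigma>: "0 < \<sigma>" "\<bar>\<sigma> - 1\<bar> \<le> h0" "mu0 * (\<sigma> - 1) = - (h * \<bar>mu0\<bar>)"
      and \<tau>: "0 < \<tau>" "\<bar>\<tau> - 1\<bar> \<le> h1" "mu1 * (\<tau> - 1) = - (h * \<bar>mu1\<bar>)"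
      using h by (auto simp: \<sigma>_def \<tau>_def)
    have "J \<sigma> \<tau> \<le> C" unfolding \<sigma>_def \<tau>_def C_def by auto
    moreover have "lam0 * (\<sigma> * (ln \<sigma> + geo_kl0 a) - e0) \<le> lam0 * (- \<eta>0)"
      using 0(3)[OF \<sigma>(2)] lam by (intro mult_left_mono) auto
    moreover have "lam1 * (\<tau> * (ln \<tau> + geo_kl1 b) - e1) \<le> lam1 * (- \<eta>1)"
      using 1(3)[OF \<tau>(2)] lam by (intro mult_left_mono) auto
    ultimately have "\<delta> \<le> C + lam0 * (- \<eta>0) - h * \<bar>mu0\<bar> + lam1 * (- \<eta>1) - h * \<bar>mu1\<bar>"
      using dual_le_geo[OF lam a(1) ab(1) ab(2) b(2) \<sigma>(1) \<tau>(1), of e0 e1 mu0 mu1] D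
      unfolding \<sigma>(3) \<tau>(3) J_def[symmetric] by linarith
    moreover have "0 \<le> lam0 * \<eta>0" "0 \<le> lam1 * \<eta>1" "0 \<le> h * \<bar>mu0\<bar>" "0 \<le> h * \<bar>mu1\<bar>"
      using lam 0 1 h by auto
    ultimately have "lam0 * \<eta>0 \<le> C" "lam1 * \<eta>1 \<le> C" "h * \<bar>mu0\<bar> \<le> C" "h * \<bar>mu1\<bar> \<le> C"
      using \<delta> by auto
    then have "lam0 \<le> C / \<eta>0" "lam1 \<le> C / \<eta>1" "\<bar>mu0\<bar> \<le> C / h" "\<bar>mu1\<bar> \<le> C / h"
      using 0 1 h by (auto simp: field_simps)
    moreover have "0 \<le> C / \<eta>0" "0 \<le> C / \<eta>1" "0 \<le> C / h" using C 0 1 h by auto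
    ultimately show ?thesis using l0 l1 unfolding R_def by linarith
  qed
  moreover have "0 < c" using \<delta> A by (simp add: c_def)
  ultimately show ?thesis by blast
qed

text \<open>Every point whose dual value is at least that of the given one lies in a compact box
  inside the open region, so a maximiser over the box is a global one.\<close>

lemma dual_attains_max:
  assumes e: "0 < e0" "0 < e1"
    and pos: "0 < l0" "0 < l1" "0 < dual e0 e1 l0 l1 u0 u1"
  shows "\<exists>lam0 lam1 mu0 mu1. 0 < lam0 \<and> 0 < lam1 \<and> (\<forall>lam0' lam1' mu0' mu1'. 0 < lam0' \<longrightarrow> 0 < lam1' \<longrightarrow>
    dual e0 e1 lam0' lam1' mu0' mu1' \<le> dual e0 e1 lam0 lam1 mu0 mu1)"
proof -
  define \<delta> where "\<delta> = dual e0 e1 l0 l1 u0 u1"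
  obtain c R where c: "0 < c" and bd: "\<And>lam0 lam1 mu0 mu1. 0 < lam0 \<Longrightarrow> 0 < lam1 \<Longrightarrow>
    \<delta> \<le> dual e0 e1 lam0 lam1 mu0 mu1 \<Longrightarrow>
    c \<le> lam0 \<and> c \<le> lam1 \<and> lam0 \<le> R \<and> lam1 \<le> R \<and> \<bar>mu0\<bar> \<le> R \<and> \<bar>mu1\<bar> \<le> R"
    using dual_superlevel_bounded[OF e, of \<delta>] pos(3) unfolding \<delta>_def by blast
  define B where "B = {c..R} \<times> {c..R} \<times> {-R..R} \<times> {-R..R}"
  define d where "d \<theta> = dual e0 e1 (fst \<theta>) (fst (snd \<theta>)) (fst (snd (snd \<theta>))) (snd (snd (snd \<theta>)))"
    for \<theta> :: "real \<times> real \<times> real \<times> real"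
  have inB: "(lam0, lam1, mu0, mu1) \<in> B" if "0 < lam0" "0 < lam1" "\<delta> \<le> dual e0 e1 lam0 lam1 mu0 mu1"
    for lam0 lam1 mu0 mu1
    using bd[OF that] by (auto simp: B_def)
  have "compact B" unfolding B_def by (intro compact_Times compact_Icc)
  moreover have start: "(l0, l1, u0, u1) \<in> B" using inB[of l0 l1 u0 u1] pos by (simp add: \<delta>_def)
  then have "B \<noteq> {}" by blast
  moreover have "continuous_on B d"
    unfolding continuous_on_sequentially o_def
  proof (intro allI ballI impI, elim conjE)
    fix S \<theta> assume S: "\<theta> \<in> B" "S \<longlonglongrightarrow> \<theta>"
    have lam: "0 < fst \<theta>" "0 < fst (snd \<theta>)" using S(1) c by (auto simp: B_def)
    note lim = tendsto_fst[OF S(2)] tendsto_fst[OF tendsto_snd[OF S(2)]]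
      tendsto_fst[OF tendsto_snd[OF tendsto_snd[OF S(2)]]] tendsto_snd[OF tendsto_snd[OF tendsto_snd[OF S(2)]]]
    show "(\<lambda>n. d (S n)) \<longlonglongrightarrow> d \<theta>"
      unfolding d_def dual_def by (intro tendsto_intros tendsto_hat[OF lam] lim)
  qed
  ultimately obtain \<theta> where \<theta>: "\<theta> \<in> B" "\<And>\<theta>'. \<theta>' \<in> B \<Longrightarrow> d \<theta>' \<le> d \<theta>"
    using continuous_attains_sup[of B d] by blast
  obtain lam0 lam1 mu0 mu1 where eq: "\<theta> = (lam0, lam1, mu0, mu1)" by (cases \<theta>) auto
  have lam: "0 < lam0" "0 < lam1" using \<theta>(1) c by (auto simp: B_def eq)
  have "dual e0 e1 lam0' lam1' mu0' mu1' \<le> dual e0 e1 lam0 lam1 mu0 mu1"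
    if "0 < lam0'" "0 < lam1'" for lam0' lam1' mu0' mu1'
  proof (cases "\<delta> \<le> dual e0 e1 lam0' lam1' mu0' mu1'")
    case True
    show ?thesis using \<theta>(2)[OF inB[OF that True]] by (simp add: d_def eq)
  next
    case False
    then show ?thesis using \<theta>(2)[OF start] by (simp add: d_def eq \<delta>_def)
  qed
  then show ?thesis using lam by blast
qed

text \<open>
  Moving from a maximiser \<open>\<theta>\<close> in the direction \<open>G(\<theta>)\<close> of the supergradient, the supergradient
  inequality at \<open>\<theta> + t G(\<theta>)\<close> gives \<open>G(\<theta> + t G(\<theta>)) \<bullet> G(\<theta>) \<le> 0\<close>; continuity of \<open>G\<close> then
  forces \<open>G(\<theta>) = 0\<close>, so no differentiability of the dual function is needed.
\<close>
lemma dual_max_multipliers: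
  assumes lam: "0 < lam0" "0 < lam1"
    and max: "\<And>lam0' lam1' mu0' mu1'. 0 < lam0' \<Longrightarrow> 0 < lam1' \<Longrightarrow>
      dual e0 e1 lam0' lam1' mu0' mu1' \<le> dual e0 e1 lam0 lam1 mu0 mu1"
  shows "multipliers M f0 f1 e0 e1 lam0 lam1 mu0 mu1"
proof -
  define a where "a = kl0 lam0 lam1 mu0 mu1 - e0"
  define b where "b = kl1 lam0 lam1 mu0 mu1 - e1"
  define c where "c = mass0 lam0 lam1 mu0 mu1 - 1"
  define d where "d = mass1 lam0 lam1 mu0 mu1 - 1"
  define t where "t n = 1 / real (Suc n)" for n
  define L0 where "L0 n = lam0 + t n * a" for n
  define L1 where "L1 n = lam1 + t n * b" for n
  define U0 where "U0 n = mu0 + t n * c" for n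
  define U1 where "U1 n = mu1 + t n * d" for n
  have t: "0 < t n" for n by (simp add: t_def)
  have t0: "t \<longlonglongrightarrow> 0" unfolding t_def[abs_def] using LIMSEQ_inverse_real_of_nat by (simp add: divide_inverse)
  have lim: "L0 \<longlonglongrightarrow> lam0" "L1 \<longlonglongrightarrow> lam1" "U0 \<longlonglongrightarrow> mu0" "U1 \<longlonglongrightarrow> mu1"
    using tendsto_add[OF tendsto_const tendsto_mult[OF t0 tendsto_const], of lam0 a]
      tendsto_add[OF tendsto_const tendsto_mult[OF t0 tendsto_const], of lam1 b]
      tendsto_add[OF tendsto_const tendsto_mult[OF t0 tendsto_const], of mu0 c]
      tendsto_add[OF tendsto_const tendsto_mult[OF t0 tendsto_const], of mu1 d]
    by (auto simp: L0_def[abs_def] L1_def[abs_def] U0_def[abs_def] U1_def[abs_def])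
  have le: "\<forall>\<^sub>F n in sequentially. a * (kl0 (L0 n) (L1 n) (U0 n) (U1 n) - e0)
     + b * (kl1 (L0 n) (L1 n) (U0 n) (U1 n) - e1)
     + c * (mass0 (L0 n) (L1 n) (U0 n) (U1 n) - 1) + d * (mass1 (L0 n) (L1 n) (U0 n) (U1 n) - 1) \<le> 0"
    using order_tendstoD(1)[OF lim(1) lam(1)] order_tendstoD(1)[OF lim(2) lam(2)]
  proof eventually_elim
    case (elim n)
    have "dual e0 e1 lam0 lam1 mu0 mu1 \<le> dual e0 e1 (L0 n) (L1 n) (U0 n) (U1 n)
      - t n * (a * (kl0 (L0 n) (L1 n) (U0 n) (U1 n) - e0) + b * (kl1 (L0 n) (L1 n) (U0 n) (U1 n) - e1)
     + c * (mass0 (L0 n) (L1 n) (U0 n) (U1 n) - 1) + d * (mass1 (L0 n) (L1 n) (U0 n) (U1 n) - 1))"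
      using dual_supergradient[OF elim lam, of e0 e1 mu0 mu1 "U0 n" "U1 n"]
      by (simp add: L0_def L1_def U0_def U1_def algebra_simps)
    with max[OF elim, of "U0 n" "U1 n"] show ?case
      using t[of n] by (smt (verit) mult_pos_pos)
  qed
  have "(\<lambda>n. a * (kl0 (L0 n) (L1 n) (U0 n) (U1 n) - e0) + b * (kl1 (L0 n) (L1 n) (U0 n) (U1 n) - e1)
     + c * (mass0 (L0 n) (L1 n) (U0 n) (U1 n) - 1) + d * (mass1 (L0 n) (L1 n) (U0 n) (U1 n) - 1))
     \<longlonglongrightarrow> a * a + b * b + c * c + d * d"
    unfolding a_def b_def c_def d_def
    by (intro tendsto_add tendsto_mult tendsto_diff tendsto_const tendsto_hat[OF lam lim])
  from tendsto_upperbound[OF this le] have "a * a + b * b + c * c + d * d \<le> 0" by simp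
  moreover have "0 \<le> a * a" "0 \<le> b * b" "0 \<le> c * c" "0 \<le> d * d" by auto
  ultimately have "a * a = 0" "b * b = 0" "c * c = 0" "d * d = 0" by linarith+
  then show ?thesis
    using lam by (simp add: multipliers_iff a_def b_def c_def d_def)
qed

lemma multipliers_exist:
  assumes "uncertainty_set M f0 e0 \<inter> uncertainty_set M f1 e1 = {}" and e: "0 < e0" "0 < e1"
  shows "\<exists>lam0 lam1 mu0 mu1. multipliers M f0 f1 e0 e1 lam0 lam1 mu0 mu1"
proof -
  obtain s where s: "0 < s" "s < 1" "e0 < geo_kl0 s" "e1 < geo_kl1 s"
    using disjoint_geo_crossing[OF assms] by blast
  from dual_positive[OF s] obtain l0 l1 u0 u1 where pos: "0 < l0" "0 < l1" "0 < dual e0 e1 l0 l1 u0 u1"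
    by blast
  from dual_attains_max[OF e pos] obtain lam0 lam1 mu0 mu1 where lam: "0 < lam0" "0 < lam1"
    and max: "\<forall>lam0' lam1' mu0' mu1'. 0 < lam0' \<longrightarrow> 0 < lam1' \<longrightarrow>
      dual e0 e1 lam0' lam1' mu0' mu1' \<le> dual e0 e1 lam0 lam1 mu0 mu1"
    by blast
  have "multipliers M f0 f1 e0 e1 lam0 lam1 mu0 mu1"
    by (rule dual_max_multipliers[OF lam]) (use max in simp)
  then show ?thesis by blast
qed

end

theorem mainTheorem3:
  fixes M :: "'a measure"
    and f0 f1 :: "'a \<Rightarrow> real"
    and \<epsilon>0 \<epsilon>1 :: real
  assumes "prob_density M f0" and "prob_density M f1"
    and "AE x in M. f0 x > 0" and "AE x in M. f1 x > 0"
    and "\<epsilon>0 > 0" and "\<epsilon>1 > 0"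
  shows "(uncertainty_set M f0 \<epsilon>0 \<inter> uncertainty_set M f1 \<epsilon>1 = {} \<longrightarrow>
            (\<exists>lam0 lam1 mu0 mu1. multipliers M f0 f1 \<epsilon>0 \<epsilon>1 lam0 lam1 mu0 mu1)) \<and>
         (\<forall>lam0 lam1 mu0 mu1. multipliers M f0 f1 \<epsilon>0 \<epsilon>1 lam0 lam1 mu0 mu1 \<longrightarrow>
            least_favorable M f0 f1 \<epsilon>0 \<epsilon>1
              (g0_hat lam0 lam1 mu0 mu1 f0 f1) (g1_hat lam0 lam1 mu0 mu1 f0 f1) \<and>
            (\<forall>g0 g1. least_favorable M f0 f1 \<epsilon>0 \<epsilon>1 g0 g1 \<longrightarrow>
               (AE x in M. g0 x = g0_hat lam0 lam1 mu0 mu1 f0 f1 x) \<and>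
               (AE x in M. g1 x = g1_hat lam0 lam1 mu0 mu1 f0 f1 x)))"
proof -
  interpret positive_densities M f0 f1 by unfold_locales fact+
  show ?thesis
    using multipliers_exist[OF _ \<open>\<epsilon>0 > 0\<close> \<open>\<epsilon>1 > 0\<close>] least_favorable_hat least_favorable_unique
    by blast
qed

end
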